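(* (a) For every $0<\alpha<1$ there exists a real number $C(\alpha)$ such that $$\sup_{\mu_0\in\mathfrak M_0}\ \sup_{0<\sigma^2<\infty}\ \sup_{\Sigma\in\mathfrak C_{Het}} P_{\mu_0,\sigma^2\Sigma}(\tilde T_{uc}\ge C(\alpha))\le\alpha. \qquad (\tilde{\mathrm S}_{uc})$$ Furthermore, even equality can be achieved in $(\tilde{\mathrm S}_{uc})$ by a proper choice of $C(\alpha)$, provided $\alpha\in(0,\alpha^*]\cap(0,1)$, where $\alpha^*=\sup_{C\in(C^*,\infty)}\sup_{\Sigma\in\mathfrak C_{Het}}P_{\mu_0,\Sigma}(\tilde T_{uc}\ge C)$ and $C^*=\max\{\tilde T_{uc}(\mu_0+e_i(n)): i\in I_1(\mathfrak M_0^{lin})\}$ for $\mu_0\in\mathfrak M_0$ (with neither $\alpha^*$ nor $C^*$ depending on the choice of $\mu_0\in\mathfrak M_0$). (b) Suppose Assumption 2 (see context) is satisfied and that $\tilde T_{Het}$ is not constant on $\mathbb R^n\setminus\tilde{\mathsf B}$. Then for every $0<\alpha<1$ there exists a real number $C(\alpha)$ such that $$\sup_{\mu_0\in\mathfrak M_0}\ \sup_{0<\sigma^2<\infty}\ \sup_{\Sigma\in\mathfrak C_{Het}} P_{\mu_0,\sigma^2\Sigma}(\tilde T_{Het}\ge C(\alpha))\le\alpha, \qquad (\tilde{\mathrm S}_{Het})$$ provided that for some $\mu_0\in\mathfrak M_0$ (and hence for all $\mu_0\in\mathfrak M_0$) $$\mu_0+e_i(n)\notin\tilde{\mathsf B}\quad\text{for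 every } i\in I_1(\mathfrak M_0^{lin}). \qquad (\tilde{\mathrm N}_{Het})$$ Furthermore, under $(\tilde{\mathrm N}_{Het})$, even equality can be achieved in $(\tilde{\mathrm S}_{Het})$ by a proper choice of $C(\alpha)$, provided $\alpha\in(0,\alpha^*]\cap(0,1)$, where now $\alpha^*=\sup_{C\in(C^*,\infty)}\sup_{\Sigma\in\mathfrak C_{Het}}P_{\mu_0,\Sigma}(\tilde T_{Het}\ge C)$ and $C^*=\max\{\tilde T_{Het}(\mu_0+e_i(n)): i\in I_1(\mathfrak M_0^{lin})\}$ for $\mu_0\in\mathfrak M_0$ (with neither $\alpha^*$ nor $C^*$ depending on the choice of $\mu_0\in\mathfrak M_0$). (c) Under the assumptions of Part (a) (there are none) (Part (b), including $(\tilde{\mathrm N}_{Het})$, respectively), a smallest critical value, denoted by $C_\Diamond(\alpha)$, satisfying $(\tilde{\mathrm S}_{uc})$ ($(\tilde{\mathrm S}_{Het})$, respectively) exists for every $0<\alpha<1$. And $C_\Diamond(\alpha)$ corresponding to Part (a) (Part (b), respectively) is also the smallest among the critical values leading to equality in $(\tilde{\mathrm S}_{uc})$ ($(\tilde{\mathrm S}_{Het})$, respectively) whenever such critical values exist.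
   Context: Setting. $n,k,q$ are integers with $1\le k<n$ and $q\ge1$; $X\in\mathbb R^{n\times k}$ has rank $k$, $R\in\mathbb R^{q\times k}$ has rank $q$, and $r\in\mathbb R^q$; all are fixed. $A'$ is the transpose of $A$, $e_i(n)$ the $i$-th standard basis vector of $\mathbb R^n$, $\Pi_{\mathcal L}$ the orthogonal projection onto a linear subspace $\mathcal L$, $\mathcal L^\bot$ its orthogonal complement. $\mathfrak M_0=\{X\beta:\beta\in\mathbb R^k, R\beta=r\}$, $\mathfrak M_0^{lin}=\{X\beta: R\beta=0\}$. $I_0(\mathfrak M_0^{lin})=\{i\in\{1,\dots,n\}: e_i(n)\in\mathfrak M_0^{lin}\}$ and $I_1(\mathfrak M_0^{lin})=\{1,\dots,n\}\setminus I_0(\mathfrak M_0^{lin})$ (nonempty since $\dim\mathfrak M_0^{lin}=k-q<n$). $P_{\mu,A}$ is the Gaussian measure on $\mathbb R^n$ with mean $\mu$ and covariance matrix $A$. $$\mathfrak C_{Het}=\Big\{\mathrm{diag}(\tau_1^2,\dots,\tau_n^2): \tau_i^2>0\text{ for all } i,\ \sum_{i=1}^n\tau_i^2=1\Big\}.$$ $\hat\beta(y)=(X'X)^{-1}X'y$; restricted residuals $\tilde u(y)=\Pi_{(\mathfrak M_0^{lin})^\bot}(y-\mu_0)$, which do not depend on the choice of $\mu_0\in\mathfrak M_0$. Test statistics. With $\tilde\sigma^2(y)=\tilde u(y)'\tilde u(y)/(n-(k-q))$, $$\tilde T_{uc}(y)=(R\hat\beta(y)-r)'\big(\tilde\sigma^2(y)R(X'X)^{-1}R'\big)^{-1}(R\hat\beta(y)-r)\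 \text{ if } y\notin\mathfrak M_0,\qquad \tilde T_{uc}(y)=0\ \text{ if } y\in\mathfrak M_0.$$ With fixed constants $\tilde d_1,\dots,\tilde d_n>0$ (possibly depending on $X$ and $R$) and $\tilde\Omega_{Het}(y)=R(X'X)^{-1}X'\,\mathrm{diag}(\tilde d_1\tilde u_1^2(y),\dots,\tilde d_n\tilde u_n^2(y))\,X(X'X)^{-1}R'$, $$\tilde T_{Het}(y)=(R\hat\beta(y)-r)'\tilde\Omega_{Het}^{-1}(y)(R\hat\beta(y)-r)\ \text{ if }\det\tilde\Omega_{Het}(y)\ne0,\qquad \tilde T_{Het}(y)=0\ \text{ otherwise}.$$ Assumption 2. Let $X'(\lnot)$ be the matrix obtained from $X'$ by deleting all columns with index $i$ such that $e_i(n)\in\mathfrak M_0^{lin}$ (no column is deleted if there is no such $i$). Then $\mathrm{rank}(R(X'X)^{-1}X'(\lnot))=q$. The set $\tilde{\mathsf B}$: $\tilde{\mathsf B}=\{y\in\mathbb R^n:\mathrm{rank}(\tilde B(y))<q\}$ with $\tilde B(y)=R(X'X)^{-1}X'\,\mathrm{diag}(\tilde u_1(y),\dots,\tilde u_n(y))$. *)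

theory Defs
  imports "HOL-Analysis.Analysis"
begin

text \<open>
  The dimensions are carried by the finite index types: \<open>n = CARD('n)\<close>, \<open>k = CARD('k)\<close>,
  \<open>q = CARD('q)\<close>.  Thus \<open>X :: real^'k^'n\<close> is an n by k matrix, \<open>R :: real^'k^'q\<close> is a q by k
  matrix, and the standard basis vector \<open>e_i(n)\<close> is \<open>axis i 1\<close>.
\<close>

definition diag :: "real^'n \<Rightarrow> real^'n^'n" where
  "diag v = (\<chi> i j. if i = j then v $ i else 0)"

definition orth_proj :: "'a::euclidean_space set \<Rightarrow> 'a \<Rightarrow> 'a" where
  "orth_proj L y = (THE p. p \<in> L \<and> y - p \<in> L\<^sup>\<bottom>)"

text \<open>Only meaningful for symmetric positive definite \<open>A\<close>; the covariance matrices \<open>\<sigma>\<^sup>2 \<Sigma>\<close>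
  with \<open>\<Sigma>\<close> in \<open>C_Het\<close> are of this kind.\<close>

definition gaussian_measure :: "real^'n \<Rightarrow> real^'n^'n \<Rightarrow> (real^'n) measure" where
  "gaussian_measure \<mu> A = density lborel
     (\<lambda>y. ennreal (exp (- ((y - \<mu>) \<bullet> (matrix_inv A *v (y - \<mu>))) / 2)
            / sqrt ((2 * pi) ^ CARD('n) * det A)))"

definition C_Het :: "(real^'n^'n) set" where
  "C_Het = {diag (\<chi> i. (\<tau> i)\<^sup>2) | \<tau> :: 'n \<Rightarrow> real.
     (\<forall>i. (\<tau> i)\<^sup>2 > 0) \<and> (\<Sum>i\<in>UNIV. (\<tau> i)\<^sup>2) = 1}"

definition M0 :: "real^'k^'n \<Rightarrow> real^'k^'q \<Rightarrow> real^'q \<Rightarrow> (real^'n) set" where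
  "M0 X R r = {X *v \<beta> | \<beta>. R *v \<beta> = r}"

definition M0_lin :: "real^'k^'n \<Rightarrow> real^'k^'q \<Rightarrow> (real^'n) set" where
  "M0_lin X R = {X *v \<beta> | \<beta>. R *v \<beta> = 0}"

definition I0 :: "(real^'n) set \<Rightarrow> 'n set" where
  "I0 L = {i. axis i 1 \<in> L}"

definition I1 :: "(real^'n) set \<Rightarrow> 'n set" where
  "I1 L = UNIV - I0 L"

definition beta_hat :: "real^'k^'n \<Rightarrow> real^'n \<Rightarrow> real^'k" where
  "beta_hat X y = matrix_inv (transpose X ** X) *v (transpose X *v y)"

text \<open>The point of \<open>M0\<close> chosen here is immaterial, see \<open>u_tilde_eq\<close> below.\<close>

definition u_tilde :: "real^'k^'n \<Rightarrow> real^'k^'q \<Rightarrow> real^'q \<Rightarrow> real^'n \<Rightarrow> real^'n" where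
  "u_tilde X R r y = orth_proj ((M0_lin X R)\<^sup>\<bottom>) (y - (SOME \<mu>0. \<mu>0 \<in> M0 X R r))"

definition sigma2_tilde :: "real^'k^'n \<Rightarrow> real^'k^'q \<Rightarrow> real^'q \<Rightarrow> real^'n \<Rightarrow> real" where
  "sigma2_tilde X R r y = (u_tilde X R r y \<bullet> u_tilde X R r y)
     / (real CARD('n) - (real CARD('k) - real CARD('q)))"

definition T_uc :: "real^'k^'n \<Rightarrow> real^'k^'q \<Rightarrow> real^'q \<Rightarrow> real^'n \<Rightarrow> real" where
  "T_uc X R r y =
     (if y \<notin> M0 X R r then
        (R *v beta_hat X y - r) \<bullet>
          (matrix_inv (sigma2_tilde X R r y *\<^sub>R
              (R ** matrix_inv (transpose X ** X) ** transpose R))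
            *v (R *v beta_hat X y - r))
      else 0)"

definition Omega_Het ::
    "real^'k^'n \<Rightarrow> real^'k^'q \<Rightarrow> real^'q \<Rightarrow> real^'n \<Rightarrow> real^'n \<Rightarrow> real^'q^'q" where
  "Omega_Het X R r d y =
     R ** matrix_inv (transpose X ** X) ** transpose X
       ** diag (\<chi> i. d $ i * (u_tilde X R r y $ i)\<^sup>2)
       ** X ** matrix_inv (transpose X ** X) ** transpose R"

definition T_Het ::
    "real^'k^'n \<Rightarrow> real^'k^'q \<Rightarrow> real^'q \<Rightarrow> real^'n \<Rightarrow> real^'n \<Rightarrow> real" where
  "T_Het X R r d y =
     (if det (Omega_Het X R r d y) \<noteq> 0 then
        (R *v beta_hat X y - r) \<bullet>
          (matrix_inv (Omega_Het X R r d y) *v (R *v beta_hat X y - r))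
      else 0)"

text \<open>The number of columns that survive the deletion depends on \<open>X\<close> and \<open>R\<close>, so the matrix
  \<open>R (X'X)\<inverse> X'(\<not>)\<close> has no type of its own.  Its columns are the columns of \<open>R (X'X)\<inverse> X'\<close> with
  index in \<open>I1 (M0_lin X R)\<close>, and its rank is the dimension of their span
  (\<open>column_rank_def\<close>); see \<open>Assumption2_iff_rank\<close> below.\<close>

definition Assumption2 :: "real^'k^'n \<Rightarrow> real^'k^'q \<Rightarrow> bool" where
  "Assumption2 X R \<longleftrightarrow>
     dim {column i (R ** matrix_inv (transpose X ** X) ** transpose X) | i.
            i \<in> I1 (M0_lin X R)} = CARD('q)"

definition B_tilde_mat ::
    "real^'k^'n \<Rightarrow> real^'k^'q \<Rightarrow> real^'q \<Rightarrow> real^'n \<Rightarrow> real^'n^'q" where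
  "B_tilde_mat X R r y =
     R ** matrix_inv (transpose X ** X) ** transpose X ** diag (u_tilde X R r y)"

definition B_tilde :: "real^'k^'n \<Rightarrow> real^'k^'q \<Rightarrow> real^'q \<Rightarrow> (real^'n) set" where
  "B_tilde X R r = {y. rank (B_tilde_mat X R r y) < CARD('q)}"

definition N_Het ::
    "real^'k^'n \<Rightarrow> real^'k^'q \<Rightarrow> real^'q \<Rightarrow> real^'n \<Rightarrow> bool" where
  "N_Het X R r \<mu>0 \<longleftrightarrow> (\<forall>i\<in>I1 (M0_lin X R). \<mu>0 + axis i 1 \<notin> B_tilde X R r)"

definition test_size ::
    "real^'k^'n \<Rightarrow> real^'k^'q \<Rightarrow> real^'q \<Rightarrow> (real^'n \<Rightarrow> real) \<Rightarrow> real \<Rightarrow> real" where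
  "test_size X R r T C =
     (SUP \<mu>0\<in>M0 X R r. SUP \<sigma>2\<in>{0<..}. SUP \<Sigma>\<in>C_Het.
        measure (gaussian_measure \<mu>0 (\<sigma>2 *\<^sub>R \<Sigma>)) {y. T y \<ge> C})"

definition C_star ::
    "real^'k^'n \<Rightarrow> real^'k^'q \<Rightarrow> (real^'n \<Rightarrow> real) \<Rightarrow> real^'n \<Rightarrow> real" where
  "C_star X R T \<mu>0 = Max ((\<lambda>i. T (\<mu>0 + axis i 1)) ` I1 (M0_lin X R))"

definition alpha_star ::
    "real^'k^'n \<Rightarrow> real^'k^'q \<Rightarrow> (real^'n \<Rightarrow> real) \<Rightarrow> real^'n \<Rightarrow> real" where
  "alpha_star X R T \<mu>0 =
     (SUP C\<in>{C_star X R T \<mu>0<..}. SUP \<Sigma>\<in>C_Het.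
        measure (gaussian_measure \<mu>0 \<Sigma>) {y. T y \<ge> C})"

definition is_smallest :: "real \<Rightarrow> real set \<Rightarrow> bool" where
  "is_smallest c S \<longleftrightarrow> c \<in> S \<and> (\<forall>x\<in>S. c \<le> x)"

lemma orth_proj_eqI:
  assumes "subspace L" "p \<in> L" "y - p \<in> L\<^sup>\<bottom>"
  shows "orth_proj L y = p"
  unfolding orth_proj_def
proof (rule the_equality)
  fix z assume z: "z \<in> L \<and> y - z \<in> L\<^sup>\<bottom>"
  have "p - z \<in> L" using assms z by (simp add: subspace_diff)
  moreover have "p - z \<in> L\<^sup>\<bottom>"
    using subspace_diff[OF subspace_orthogonal_comp, of "y - z" L "y - p"] assms z by simp
  ultimately show "z = p"
    by (auto simp: orthogonal_comp_def orthogonal_def)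
qed (use assms in simp)

lemma orth_proj_exists:
  fixes L :: "'a::euclidean_space set"
  assumes "subspace L"
  shows "orth_proj L y \<in> L \<and> y - orth_proj L y \<in> L\<^sup>\<bottom>"
proof -
  have "span L = L" using assms by simp
  then obtain p z where "p \<in> L" "\<And>w. w \<in> L \<Longrightarrow> orthogonal z w" "y = p + z"
    using orthogonal_subspace_decomp_exists[of L y] by metis
  then have "p \<in> L" "y - p \<in> L\<^sup>\<bottom>"
    by (auto simp: orthogonal_comp_def orthogonal_commute)
  then show ?thesis using orth_proj_eqI[OF assms] by metis
qed

lemma subspace_M0_lin: "subspace (M0_lin X R)"
proof (rule subspaceI)
  show "0 \<in> M0_lin X R"
    unfolding M0_lin_def by (smt (verit) matrix_vector_mult_0_right mem_Collect_eq)
next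
  fix x y assume "x \<in> M0_lin X R" "y \<in> M0_lin X R"
  then obtain b c where "x = X *v b" "R *v b = 0" "y = X *v c" "R *v c = 0"
    unfolding M0_lin_def by auto
  then have "x + y = X *v (b + c)" "R *v (b + c) = 0"
    by (simp_all add: matrix_vector_right_distrib)
  then show "x + y \<in> M0_lin X R" unfolding M0_lin_def by blast
next
  fix c :: real and x assume "x \<in> M0_lin X R"
  then obtain b where "x = X *v b" "R *v b = 0" unfolding M0_lin_def by auto
  then have "c *\<^sub>R x = X *v (c *\<^sub>R b)" "R *v (c *\<^sub>R b) = 0"
    by (simp_all add: matrix_vector_mult_scaleR)
  then show "c *\<^sub>R x \<in> M0_lin X R" unfolding M0_lin_def by blast
qed

lemma u_tilde_eq:
  assumes "\<mu>0 \<in> M0 X R r"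
  shows "u_tilde X R r y = orth_proj ((M0_lin X R)\<^sup>\<bottom>) (y - \<mu>0)"
proof -
  let ?L = "M0_lin X R"
  define m where "m = (SOME \<mu>0. \<mu>0 \<in> M0 X R r)"
  have "m \<in> M0 X R r" unfolding m_def using assms by (rule someI)
  then obtain b c where bc: "m = X *v b" "R *v b = r" "\<mu>0 = X *v c" "R *v c = r"
    using assms unfolding M0_def by auto
  then have "\<mu>0 - m = X *v (c - b)" "R *v (c - b) = 0"
    by (simp_all add: matrix_vector_mult_diff_distrib)
  then have d: "\<mu>0 - m \<in> ?L" unfolding M0_lin_def by blast
  let ?p = "orth_proj (?L\<^sup>\<bottom>) (y - \<mu>0)"
  have p: "?p \<in> ?L\<^sup>\<bottom>" "y - \<mu>0 - ?p \<in> ?L"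
    using orth_proj_exists[OF subspace_orthogonal_comp, of ?L "y - \<mu>0"]
    by (simp_all add: orthogonal_comp_self subspace_M0_lin)
  have "y - m - ?p = (y - \<mu>0 - ?p) + (\<mu>0 - m)" by simp
  also have "\<dots> \<in> ?L" using p d subspace_M0_lin subspace_add by blast
  finally have "y - m - ?p \<in> (?L\<^sup>\<bottom>)\<^sup>\<bottom>"
    by (simp add: orthogonal_comp_self subspace_M0_lin)
  then show ?thesis
    unfolding u_tilde_def m_def[symmetric]
    using orth_proj_eqI[OF subspace_orthogonal_comp p(1)] by blast
qed

lemma I1_nonempty:
  fixes X :: "real^'k^'n"
  assumes "CARD('k) < CARD('n)"
  shows "I1 (M0_lin X R) \<noteq> {}"
proof
  assume "I1 (M0_lin X R) = {}"
  then have "(axis i 1 :: real^'n) \<in> range ((*v) X)" for i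
    unfolding I1_def I0_def M0_lin_def by fastforce
  then have "(Basis :: (real^'n) set) \<subseteq> range ((*v) X)"
    by (auto simp: Basis_vec_def)
  then have "dim (Basis :: (real^'n) set) \<le> dim (range ((*v) X))"
    by (rule dim_subset)
  moreover have "dim (Basis :: (real^'n) set) = CARD('n)"
    by (simp add: dim_eq_card_independent independent_Basis)
  moreover have "dim (range ((*v) X)) \<le> CARD('k)"
    using rank_bound[of X] unfolding rank_dim_range[symmetric] by simp
  ultimately show False using assms by linarith
qed

lemma Assumption2_iff_rank:
  fixes X :: "real^'k^'n" and R :: "real^'k^'q" and \<iota> :: "'m::finite \<Rightarrow> 'n"
  assumes "bij_betw \<iota> UNIV (I1 (M0_lin X R))"
  shows "Assumption2 X R \<longleftrightarrow>
    rank (R ** matrix_inv (transpose X ** X) ** (\<chi> i j. transpose X $ i $ \<iota> j)) = CARD('q)"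
proof -
  let ?A = "R ** matrix_inv (transpose X ** X)"
  have "column j (?A ** (\<chi> i j. transpose X $ i $ \<iota> j)) = column (\<iota> j) (?A ** transpose X)" for j
    by (simp add: column_def matrix_matrix_mult_def vec_eq_iff)
  moreover have "I1 (M0_lin X R) = range \<iota>"
    using assms by (simp add: bij_betw_def)
  ultimately have "columns (?A ** (\<chi> i j. transpose X $ i $ \<iota> j)) =
      {column i (?A ** transpose X) | i. i \<in> I1 (M0_lin X R)}"
    unfolding columns_def by auto
  then show ?thesis unfolding Assumption2_def column_rank_def by simp
qed

end

theory Submission
  imports Defs "HOL-Probability.Distributions"
begin

text \<open>
  Both statistics satisfy \<open>T (\<mu>0 + w) = g w\<close> with \<open>g = N / D\<close> a ratio of polynomials (Cramer's rule),
  where \<open>g\<close> is homogeneous of degree 0 and invariant under translation by \<open>M0_lin\<close>.  Hence the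
  rejection probability depends on \<open>\<tau>\<close> alone, and even only on the coordinates of \<open>\<tau>\<close> in \<open>I1\<close>,
  rescaled to norm 1.  These vectors range over a set with compact closure.  At a boundary point
  \<open>\<tau>\<close> some axis with index in \<open>I1\<close> survives; there \<open>D\<close> does not vanish and \<open>g\<close> is at most
  \<open>C*\<close>, so neither the polynomial \<open>D\<close> nor \<open>N - C D\<close> with \<open>C > C*\<close> vanishes identically on the
  support of the limiting Gaussian.  Zero sets of nonzero polynomials being null,
  \<open>P\<^sub>\<tau>(g \<ge> C)\<close> is jointly continuous in \<open>\<tau>\<close> and \<open>C > C*\<close> up to the boundary, and
  tends to 0 as \<open>C\<close> grows.  For interior \<open>\<tau>\<close> there are no atoms at any \<open>C\<close> since \<open>g\<close> is not
  constant; so the infimum of the valid critical values is itself valid.  If it exceeds \<open>C*\<close>, its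
  size is exactly \<open>\<alpha>\<close> by compactness; if not, its size is at least \<open>\<alpha>*\<close> by monotonicity.
\<close>

subsection \<open>Polynomials and Gaussian measures\<close>

text \<open>By Fubini along the rays through \<open>x0\<close>, almost every dilate about \<open>x0\<close> of the zero set is
  null, and dilations preserve null sets.\<close>

lemma AE_real_polynomial_function_nonzero:
  fixes f :: "'a::euclidean_space \<Rightarrow> real"
  assumes f: "real_polynomial_function f" and x0: "f x0 \<noteq> 0"
  shows "AE x in lborel. f x \<noteq> 0"
proof -
  have "continuous_on UNIV f"
    using f by (simp add: continuous_on_polymonial_function real_polynomial_function_eq)
  then have [measurable]: "f \<in> borel_measurable borel"
    by (rule borel_measurable_continuous_onI)
  have ray: "AE t in lborel. f (x0 + t *\<^sub>R (x - x0)) \<noteq> 0" for x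
  proof -
    have "polynomial_function (\<lambda>t::real. x0 + t *\<^sub>R (x - x0))"
      by (intro polynomial_function_add polynomial_function_const
          polynomial_function_bounded_linear bounded_linear_scaleR_left)
    from real_polynomial_function_compose[OF this f]
    have "real_polynomial_function (\<lambda>t::real. f (x0 + t *\<^sub>R (x - x0)))"
      by (simp add: o_def)
    then obtain a n where an: "(\<lambda>t. f (x0 + t *\<^sub>R (x - x0))) = (\<lambda>t. \<Sum>i\<le>n. a i * t ^ i)"
      using real_polynomial_function_iff_sum by metis
    \<comment> \<open>At \<open>t = 0\<close> the ray passes through \<open>x0\<close>, so
      \<open>a 0 = f x0\<close> and the polynomial in \<open>t\<close> is not the zero
      polynomial.\<close>
    have "a 0 \<noteq> 0"
      using fun_cong[OF an, of 0] x0 by (simp add: sum.atMost_shift)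
    then have "finite {t. (\<Sum>i\<le>n. a i * t ^ i) = 0}"
      using polyfun_finite_roots[of a n] by blast
    then have "finite {t. f (x0 + t *\<^sub>R (x - x0)) = 0}"
      using an by (metis (no_types, lifting) Collect_cong)
    then have "{t. f (x0 + t *\<^sub>R (x - x0)) = 0} \<in> null_sets lborel"
      by (rule finite_imp_null_set_lborel)
    then show ?thesis by (rule AE_I') auto
  qed
  have [measurable]: "(\<lambda>z. f (x0 + snd z *\<^sub>R (fst z - x0))) \<in> borel_measurable (lborel \<Otimes>\<^sub>M (lborel :: real measure))"
    by measurable
  have meas: "{z \<in> space (lborel \<Otimes>\<^sub>M (lborel :: real measure)). f (x0 + snd z *\<^sub>R (fst z - x0)) \<noteq> 0}
      \<in> sets (lborel \<Otimes>\<^sub>M lborel)"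
    by measurable
  from ray have "AE x in lborel. AE t in lborel. f (x0 + t *\<^sub>R (x - x0)) \<noteq> 0"
    by simp
  then have "AE t in lborel. AE x in lborel. f (x0 + t *\<^sub>R (x - x0)) \<noteq> 0"
    by (rule iffD1[OF lborel_pair.AE_commute[of "\<lambda>x t. f (x0 + t *\<^sub>R (x - x0)) \<noteq> 0", OF meas]])
  moreover have "AE t in lborel. t \<noteq> (0::real)"
    by (rule AE_lborel_singleton)
  ultimately have ev: "AE t in lborel. t \<noteq> 0 \<and> (AE x in lborel. f (x0 + t *\<^sub>R (x - x0)) \<noteq> 0)"
    by eventually_elim simp
  have bot: "ae_filter (lborel :: real measure) \<noteq> bot"
    by (simp add: ae_filter_eq_bot_iff)
  obtain t :: real where t: "t \<noteq> 0" "AE x in lborel. f (x0 + t *\<^sub>R (x - x0)) \<noteq> 0"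
    using eventually_happens'[OF bot ev] by blast
  \<comment> \<open>For this fixed \<open>t\<close> the dilation about \<open>x0\<close> preserves
    null sets, which carries the statement from the dilate back to \<open>f\<close> itself.\<close>
  have eq: "(lborel :: 'a measure) =
      density (distr lborel borel (\<lambda>x. (x0 - t *\<^sub>R x0) + t *\<^sub>R x)) (\<lambda>_. \<bar>t\<bar> ^ DIM('a))"
    by (rule lborel_affine[OF t(1)])
  have "AE x in lborel. f ((x0 - t *\<^sub>R x0) + t *\<^sub>R x) \<noteq> 0"
    using t(2) by (simp add: algebra_simps)
  then have "AE x in distr lborel borel (\<lambda>x. (x0 - t *\<^sub>R x0) + t *\<^sub>R x). f x \<noteq> 0"
    by (subst AE_distr_iff) simp_all
  then have "AE x in density (distr lborel borel (\<lambda>x. (x0 - t *\<^sub>R x0) + t *\<^sub>R x)) (\<lambda>_. \<bar>t\<bar> ^ DIM('a)). f x \<noteq> 0"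
    by (subst AE_density) simp_all
  then show ?thesis
    by (simp only: eq[symmetric])
qed

section \<open>The standard Gaussian measure and its diagonal images\<close>

abbreviation std_gaussian :: "(real^'n) measure" where
  "std_gaussian \<equiv> gaussian_measure 0 (mat 1)"

lemma matrix_inv_eqI:
  fixes A B :: "real^'n^'n"
  assumes "A ** B = mat 1"
  shows "matrix_inv A = B"
proof -
  have BA: "B ** A = mat 1"
    using assms by (simp add: matrix_left_right_inverse)
  then have "invertible A"
    using assms invertible_def by blast
  then have "matrix_inv A ** A = mat 1"
    unfolding invertible_def matrix_inv_def by (rule someI2_ex) simp
  then have "matrix_inv A ** (A ** B) = B"
    by (simp only: matrix_mul_assoc matrix_mul_lid)
  then show ?thesis using assms by simp
qed

text \<open>The product of two vectors is componentwise; diagonal scaling is written this way from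
  here on.\<close>

lemma diag_mult_vec: "diag v *v x = v * (x :: real^'n)"
proof -
  have "(\<Sum>j\<in>UNIV. (if i = j then v $ i else 0) * x $ j) = v $ i * x $ i" for i
  proof -
    have "(\<Sum>j\<in>UNIV. (if i = j then v $ i else 0) * x $ j) = (\<Sum>j\<in>UNIV. if i = j then v $ i * x $ j else 0)"
      by (rule sum.cong) auto
    then show ?thesis by simp
  qed
  then show ?thesis
    by (simp only: vec_eq_iff matrix_vector_mult_def diag_def vec_lambda_beta vector_mult_component simp_thms)
qed

lemma matrix_inv_diag:
  fixes v :: "real^'n"
  assumes "\<And>i. v $ i \<noteq> 0"
  shows "matrix_inv (diag v) = diag (\<chi> i. 1 / v $ i)"
proof (rule matrix_inv_eqI)
  have "(diag v ** diag (\<chi> i. 1 / v $ i)) *v x = mat 1 *v x" for x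
    using assms
    by (simp add: matrix_vector_mul_assoc[symmetric] diag_mult_vec vec_eq_iff del: matrix_vector_mul_component)
  then show "diag v ** diag (\<chi> i. 1 / v $ i) = mat 1"
    by (simp only: matrix_eq simp_thms)
qed

lemma det_diag: "det (diag v) = (\<Prod>i\<in>UNIV. v $ i)"
  by (subst det_diagonal) (simp_all add: diag_def)

lemma prod_Basis_vec:
  fixes h :: "real^'n \<Rightarrow> 'b::comm_monoid_mult"
  shows "(\<Prod>b\<in>Basis. h b) = (\<Prod>i\<in>UNIV. h (axis i 1))"
proof -
  have eq: "(Basis :: (real^'n) set) = range (\<lambda>i. axis i 1)"
    by (auto simp: Basis_vec_def)
  have "inj (\<lambda>i::'n. axis i (1::real))"
    by (simp add: inj_on_def axis_eq_axis)
  from prod.reindex[OF this, of h] show ?thesis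
    by (simp add: eq)
qed

lemma std_gaussian_eq:
  "std_gaussian = density lborel
     (\<lambda>z::real^'n. ennreal (exp (- (z \<bullet> z) / 2) / sqrt ((2 * pi) ^ CARD('n))))"
proof -
  have "matrix_inv (mat 1 :: real^'n^'n) = mat 1"
    by (rule matrix_inv_eqI) simp
  then show ?thesis by (simp add: gaussian_measure_def)
qed

text \<open>The density factors into one-dimensional standard normal densities, each of integral
  1.\<close>

lemma prob_space_std_gaussian: "prob_space (std_gaussian :: (real^'n) measure)"
proof (rule prob_spaceI)
  have "exp (- (z \<bullet> z) / 2) / sqrt ((2 * pi) ^ CARD('n))
      = (\<Prod>b\<in>Basis. std_normal_density (z \<bullet> b))" for z :: "real^'n"
  proof -
    have "(\<Prod>i\<in>UNIV. std_normal_density (z $ i)) = (1 / sqrt (2 * pi)) ^ CARD('n) * exp (\<Sum>i\<in>UNIV. - (z $ i)\<^sup>2 / 2)"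
      by (simp only: std_normal_density_def prod.distrib exp_sum[OF finite] prod_constant)
    also have "(\<Sum>i\<in>UNIV. - (z $ i)\<^sup>2 / 2) = - (z \<bullet> z) / 2"
      by (simp add: inner_vec_def power2_eq_square sum_divide_distrib sum_negf)
    finally show ?thesis
      by (simp only: prod_Basis_vec inner_axis real_sqrt_power power_one_over inner_real_def) simp
  qed
  then have "emeasure (std_gaussian :: (real^'n) measure) (space std_gaussian)
      = (\<integral>\<^sup>+z. (\<Prod>b\<in>(Basis::(real^'n) set). ennreal (std_normal_density (z \<bullet> b))) \<partial>lborel)"
    by (simp add: std_gaussian_eq emeasure_density prod_ennreal)
  also have "\<dots> = (\<Prod>b\<in>(Basis :: (real^'n) set). \<integral>\<^sup>+x. ennreal (std_normal_density x) \<partial>lborel)"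
    by (rule nn_integral_lborel_prod) auto
  also have "(\<integral>\<^sup>+x. ennreal (std_normal_density x) \<partial>lborel) = 1"
    by (simp add: nn_integral_eq_integral)
  finally show "emeasure (std_gaussian :: (real^'n) measure) (space std_gaussian) = 1" by simp
qed

text \<open>Change of variables. All covariances are moved into the map, so that one fixed measure
  remains and limits in the scales can be taken by dominated convergence.\<close>

lemma gaussian_measure_diag_eq_distr:
  fixes a \<mu> :: "real^'n"
  assumes a: "\<And>i. a $ i > 0"
  shows "gaussian_measure \<mu> (diag (\<chi> i. (a $ i)\<^sup>2)) = distr std_gaussian borel (\<lambda>z. \<mu> + a * z)"
proof -
  let ?T = "\<lambda>z. \<mu> + a * z"
  let ?c = "\<Prod>j\<in>(Basis :: (real^'n) set). \<bar>a \<bullet> j\<bar>"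
  have T_eq: "\<mu> + (\<Sum>j\<in>Basis. ((a \<bullet> j) * (z \<bullet> j)) *\<^sub>R j) = ?T z" for z
  proof -
    have "(\<Sum>j\<in>Basis. ((a \<bullet> j) * (z \<bullet> j)) *\<^sub>R j) = (\<Sum>j\<in>Basis. ((a * z) \<bullet> j) *\<^sub>R j)"
      by (rule sum.cong) (auto simp: Basis_vec_def inner_axis)
    then show ?thesis by (simp add: euclidean_representation)
  qed
  have nz: "a \<bullet> j \<noteq> 0" if j: "j \<in> Basis" for j
  proof -
    obtain i where "j = axis i 1" using j by (auto simp: Basis_vec_def)
    then show ?thesis using a[of i] by (simp add: inner_axis)
  qed
  have lb: "(lborel :: (real^'n) measure) = density (distr lborel borel ?T) (\<lambda>_. ennreal ?c)"
    using lborel_affine_euclidean[of "\<lambda>j. a \<bullet> j" \<mu>, OF nz] unfolding T_eq by simp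
  have T_cont: "continuous_on UNIV ?T"
    unfolding diag_mult_vec[symmetric]
    by (intro continuous_intros linear_continuous_on) simp
  then have [measurable]: "?T \<in> borel \<rightarrow>\<^sub>M borel"
    by (rule borel_measurable_continuous_onI)
  let ?v = "\<chi> i. (a $ i)\<^sup>2"
  let ?\<phi> = "\<lambda>y. ennreal (exp (- ((y - \<mu>) \<bullet> (matrix_inv (diag ?v) *v (y - \<mu>))) / 2)
            / sqrt ((2 * pi) ^ CARD('n) * det (diag ?v)))"
  have c: "?c = (\<Prod>i\<in>UNIV. a $ i)"
    using a by (simp add: prod_Basis_vec inner_axis abs_of_pos)
  have cpos: "?c > 0"
    unfolding c using a by (simp add: prod_pos)
  have det: "det (diag ?v) = ?c\<^sup>2"
    unfolding c det_diag by (simp add: prod_power_distrib)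
  have inv: "matrix_inv (diag ?v) = diag (\<chi> i. 1 / (a $ i)\<^sup>2)"
    using a by (subst matrix_inv_diag) (simp_all add: less_imp_neq[THEN not_sym])
  \<comment> \<open>The Jacobian \<open>?c\<close> is the square root of the determinant, so it
    cancels that factor of the normalizing constant.\<close>
  have \<phi>_eq: "?c * ?\<phi> (?T z) = ennreal (exp (- (z \<bullet> z) / 2) / sqrt ((2 * pi) ^ CARD('n)))" for z
  proof -
    have "(\<chi> i. 1 / (a $ i)\<^sup>2) * (a * z) = (\<chi> i. z $ i / a $ i)"
      using a by (simp add: vec_eq_iff power2_eq_square)
    moreover have "(a * z) \<bullet> (\<chi> i. z $ i / a $ i) = z \<bullet> z"
    proof -
      have "a $ i * z $ i * (z $ i / a $ i) = z $ i * z $ i" for i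
        using a[of i] by simp
      then show ?thesis by (simp add: inner_vec_def)
    qed
    ultimately have "(a * z) \<bullet> ((\<chi> i. 1 / (a $ i)\<^sup>2) * (a * z)) = z \<bullet> z"
      by simp
    moreover have "sqrt ((2 * pi) ^ CARD('n) * ?c\<^sup>2) = sqrt ((2 * pi) ^ CARD('n)) * ?c"
      using cpos by (simp only: real_sqrt_mult real_sqrt_abs abs_of_pos)
    ultimately have "?\<phi> (?T z) = ennreal (exp (- (z \<bullet> z) / 2) / (sqrt ((2 * pi) ^ CARD('n)) * ?c))"
      by (simp only: inv diag_mult_vec det add_diff_cancel_left')
    moreover have "c * (e / (s * c)) = e / s" if "c > 0" for c e s :: real
      using that by simp
    ultimately show ?thesis
      using cpos by (simp only: ennreal_mult'[symmetric] less_imp_le)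
  qed
  have "continuous_on UNIV (\<lambda>y. (y - \<mu>) \<bullet> (matrix_inv (diag ?v) *v (y - \<mu>)))"
    by (intro continuous_intros bounded_linear.continuous_on[OF matrix_vector_mul_bounded_linear])
  then have [measurable]: "(\<lambda>y. (y - \<mu>) \<bullet> (matrix_inv (diag ?v) *v (y - \<mu>))) \<in> borel_measurable borel"
    by (rule borel_measurable_continuous_onI)
  have "gaussian_measure \<mu> (diag ?v) = density (density (distr lborel borel ?T) (\<lambda>_. ennreal ?c)) ?\<phi>"
    unfolding gaussian_measure_def using lb by simp
  also have "\<dots> = density (distr lborel borel ?T) (\<lambda>y. ennreal ?c * ?\<phi> y)"
    by (rule density_density_eq) simp_all
  also have "\<dots> = distr (density lborel (\<lambda>z. ennreal ?c * ?\<phi> (?T z))) borel ?T"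
    by (rule density_distr) simp_all
  also have "\<dots> = distr std_gaussian borel ?T"
    unfolding \<phi>_eq std_gaussian_eq ..
  finally show ?thesis .
qed

subsection \<open>Homogeneous rational statistics of Gaussian vectors\<close>

text \<open>Here \<tau> holds standard deviations, not variances. Pushing
  \<open>std_gaussian\<close> through \<tau> also makes sense when entries of \<tau> vanish and the
  Gaussian law has no density.\<close>

definition exceed_prob :: "(real^'n \<Rightarrow> real) \<Rightarrow> real^'n \<Rightarrow> real \<Rightarrow> real" where
  "exceed_prob g \<tau> C = measure std_gaussian {z. g (\<tau> * z) \<ge> C}"

text \<open>The standard deviations belonging to the matrices in \<open>C_Het\<close>, see
  \<open>C_Het_eq\<close>.\<close>

definition unit_scales :: "(real^'n) set" where
  "unit_scales = {\<tau>. (\<forall>i. \<tau> $ i > 0) \<and> norm \<tau> = 1}"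

definition max_exceed_prob :: "(real^'n \<Rightarrow> real) \<Rightarrow> real \<Rightarrow> real" where
  "max_exceed_prob g C = (SUP \<tau>\<in>unit_scales. exceed_prob g \<tau> C)"

lemma bounded_linear_mult_vec: "bounded_linear (\<lambda>z::real^'n. \<tau> * z)"
  unfolding diag_mult_vec[symmetric] by (rule matrix_vector_mul_bounded_linear)

lemma sets_std_gaussian [simp, measurable_cong]: "sets std_gaussian = sets borel"
  by (simp add: std_gaussian_eq)

lemma space_std_gaussian [simp]: "space std_gaussian = UNIV"
  by (simp add: std_gaussian_eq)

lemma exceed_prob_le_1: "exceed_prob g \<tau> C \<le> 1"
  unfolding exceed_prob_def by (rule prob_space.prob_le_1[OF prob_space_std_gaussian])

lemma bdd_above_exceed_prob: "bdd_above ((\<lambda>\<tau>. exceed_prob g \<tau> C) ` A)"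
  using exceed_prob_le_1 by (auto simp: bdd_above_def)

lemma pos_scale_normalize:
  fixes \<tau> :: "real^'n"
  assumes "\<And>i. \<tau> $ i > 0"
  shows "norm \<tau> > 0" "(1 / norm \<tau>) *\<^sub>R \<tau> \<in> unit_scales"
proof -
  have "\<tau> $ undefined \<noteq> 0" using assms[of undefined] by simp
  then have "\<tau> \<noteq> 0" by auto
  then show "norm \<tau> > 0" by simp
  then show "(1 / norm \<tau>) *\<^sub>R \<tau> \<in> unit_scales"
    using assms by (simp add: unit_scales_def)
qed

lemma unit_scales_nonempty: "unit_scales \<noteq> ({} :: (real^'n) set)"
  using pos_scale_normalize(2)[of "\<chi> i. 1"] by auto

text \<open>The composition with \<tau> is a polynomial in \<open>z\<close> that is nonzero at
  \<open>w\<close>. Entries of \<tau> may vanish: \<open>h\<close> only has to be nonzero somewhere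
  on the image of \<tau>, the support of the possibly degenerate law.\<close>

lemma AE_std_gaussian_polynomial:
  fixes h :: "real^'n \<Rightarrow> real"
  assumes h: "real_polynomial_function h" and "h (\<tau> * w) \<noteq> 0"
  shows "AE z in std_gaussian. h (\<tau> * z) \<noteq> 0"
proof -
  have "real_polynomial_function (\<lambda>z. h (\<tau> * z))"
    using real_polynomial_function_compose[OF
        polynomial_function_bounded_linear[OF bounded_linear_mult_vec] h]
    by (simp add: o_def)
  from AE_real_polynomial_function_nonzero[OF this, of w] assms(2)
  have "AE z in lborel. h (\<tau> * z) \<noteq> 0" by simp
  then show ?thesis
    unfolding std_gaussian_eq by (subst AE_density) (auto elim!: eventually_mono)
qed

text \<open>The common features of both statistics after centring at a point of \<open>M0\<close>.
  Since \<open>x / 0 = 0\<close>, \<open>g_eq\<close> also gives the value 0 on the zeros of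
  \<open>D\<close>. \<open>D_axis\<close> serves the degenerate limiting laws,
  \<open>nonconstant\<close> those with positive scales.\<close>

locale homogeneous_ratio =
  fixes N D g :: "real^'n \<Rightarrow> real" and L :: "(real^'n) set"
  assumes polynomial_N: "real_polynomial_function N"
    and polynomial_D: "real_polynomial_function D"
    and g_eq: "g w = N w / D w"
    and g_scale: "c \<noteq> 0 \<Longrightarrow> g (c *\<^sub>R w) = g w"
    and subspace_L: "subspace L"
    and g_shift: "l \<in> L \<Longrightarrow> g (w + l) = g w"
    and D_axis: "i \<in> I1 L \<Longrightarrow> D (axis i 1) \<noteq> 0"
    and I1_nonempty: "I1 L \<noteq> {}"
    and nonconstant: "\<exists>w1 w2. D w1 \<noteq> 0 \<and> D w2 \<noteq> 0 \<and> g w1 \<noteq> g w2"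
begin

text \<open>The closure of the vectors obtained from \<open>unit_scales\<close> by deleting the coordinates outside
  \<open>I1 L\<close>, which do not influence \<open>g\<close>, and renormalizing.\<close>

definition scale_closure :: "(real^'n) set" where
  "scale_closure = {\<tau>. (\<forall>i. \<tau> $ i \<ge> 0) \<and> (\<forall>i. i \<notin> I1 L \<longrightarrow> \<tau> $ i = 0) \<and> norm \<tau> = 1}"

text \<open>This is the \<open>C*\<close> of the theorem, see \<open>C_star_eq\<close>.\<close>

definition axis_max :: real where
  "axis_max = Max ((\<lambda>i. g (axis i 1)) ` I1 L)"

lemma continuous_N: "continuous_on UNIV N" and continuous_D: "continuous_on UNIV D"
  using polynomial_N polynomial_D
  by (simp_all add: continuous_on_polymonial_function real_polynomial_function_eq)

lemma measurable_g [measurable]: "g \<in> borel_measurable borel"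
proof -
  have [measurable]: "N \<in> borel_measurable borel" "D \<in> borel_measurable borel"
    using continuous_N continuous_D by (auto intro: borel_measurable_continuous_onI)
  have "(\<lambda>w. N w / D w) \<in> borel_measurable borel" by measurable
  then show ?thesis by (simp add: g_eq[symmetric])
qed

lemma measurable_mult_vec [measurable]: "(\<lambda>z::real^'n. \<tau> * z) \<in> borel \<rightarrow>\<^sub>M borel"
  by (intro borel_measurable_continuous_onI linear_continuous_on bounded_linear_mult_vec)

lemma isCont_g: "D w \<noteq> 0 \<Longrightarrow> isCont g w"
proof -
  assume "D w \<noteq> 0"
  moreover have "isCont N w" "isCont D w"
    using continuous_N continuous_D by (auto simp: continuous_on_eq_continuous_at)
  ultimately have "isCont (\<lambda>w. N w / D w) w" by (intro continuous_intros)
  then show ?thesis by (simp add: g_eq[symmetric])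
qed

lemma exceed_prob_scale: "c \<noteq> 0 \<Longrightarrow> exceed_prob g (c *\<^sub>R \<tau>) C = exceed_prob g \<tau> C"
proof -
  assume c: "c \<noteq> 0"
  have "c *\<^sub>R \<tau> * z = c *\<^sub>R (\<tau> * z)" for z by (simp add: vec_eq_iff)
  then show ?thesis using c by (simp add: exceed_prob_def g_scale)
qed

lemma exceed_prob_restrict:
  "exceed_prob g (\<chi> i. if i \<in> I1 L then \<tau> $ i else 0) C = exceed_prob g \<tau> C"
proof -
  have "g ((\<chi> i. if i \<in> I1 L then \<tau> $ i else 0) * z) = g (\<tau> * z)" for z
  proof -
    let ?l = "\<chi> i. if i \<in> I1 L then 0 else \<tau> $ i * z $ i"
    \<comment> \<open>The discarded part is a combination of basis vectors with index in
      \<open>I0 L\<close>; these lie in \<open>L\<close>, and \<open>g\<close> ignores shifts by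
      \<open>L\<close>.\<close>
    have "?l = (\<Sum>i\<in>UNIV. (?l $ i) *\<^sub>R axis i 1)"
      using basis_expansion[of ?l] by (simp only: scalar_mult_eq_scaleR)
    also have "\<dots> \<in> L"
      using subspace_L by (intro subspace_sum) (auto simp: I1_def I0_def subspace_0 intro: subspace_scale)
    finally have "?l \<in> L" .
    then have "g ((\<chi> i. if i \<in> I1 L then \<tau> $ i else 0) * z + ?l)
        = g ((\<chi> i. if i \<in> I1 L then \<tau> $ i else 0) * z)"
      by (rule g_shift)
    moreover have "(\<chi> i. if i \<in> I1 L then \<tau> $ i else 0) * z + ?l = \<tau> * z"
      by (simp add: vec_eq_iff)
    ultimately show ?thesis by simp
  qed
  then show ?thesis by (simp add: exceed_prob_def)
qed

lemma exceed_prob_le_max: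
  assumes "\<And>i. \<tau> $ i > 0"
  shows "exceed_prob g \<tau> C \<le> max_exceed_prob g C"
proof -
  have "exceed_prob g ((1 / norm \<tau>) *\<^sub>R \<tau>) C \<le> max_exceed_prob g C"
    unfolding max_exceed_prob_def
    by (rule cSUP_upper[OF pos_scale_normalize(2)[OF assms] bdd_above_exceed_prob])
  then show ?thesis
    using pos_scale_normalize(1)[OF assms] by (simp add: exceed_prob_scale)
qed

text \<open>Deleting the coordinates outside \<open>I1 L\<close> and renormalizing keeps the
  exceedance probability and moves a near-maximizer into the compact set
  \<open>scale_closure\<close>, where subsequences converge.\<close>

lemma less_max_exceed_prob:
  assumes "a < max_exceed_prob g C"
  obtains \<kappa> where "\<kappa> \<in> scale_closure" "a < exceed_prob g \<kappa> C"
proof -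
  obtain \<tau> where \<tau>: "\<tau> \<in> unit_scales" "a < exceed_prob g \<tau> C"
    using assms less_cSUP_iff[OF unit_scales_nonempty bdd_above_exceed_prob]
    unfolding max_exceed_prob_def by blast
  define \<rho> where "\<rho> = (\<chi> i. if i \<in> I1 L then \<tau> $ i else 0)"
  obtain i where i: "i \<in> I1 L" using I1_nonempty by blast
  then have "\<rho> $ i \<noteq> 0" using \<tau>(1) by (simp add: \<rho>_def unit_scales_def less_imp_neq[THEN not_sym])
  then have \<rho>: "norm \<rho> > 0" by auto
  have "(1 / norm \<rho>) *\<^sub>R \<rho> \<in> scale_closure"
    using \<rho> \<tau>(1) by (auto simp: scale_closure_def \<rho>_def unit_scales_def less_imp_le)
  moreover have "exceed_prob g ((1 / norm \<rho>) *\<^sub>R \<rho>) C = exceed_prob g \<tau> C"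
    using \<rho> exceed_prob_restrict[of \<tau> C] by (simp add: exceed_prob_scale \<rho>_def)
  ultimately show thesis using that \<tau>(2) by metis
qed

section \<open>Limiting scale vectors and null level sets\<close>

lemma compact_scale_closure: "compact scale_closure"
proof -
  have "bounded scale_closure"
    by (rule boundedI[where B = 1]) (simp add: scale_closure_def)
  moreover have "closed scale_closure"
    unfolding scale_closure_def
    by (intro closed_Collect_conj closed_Collect_all closed_Collect_imp closed_Collect_le
        closed_Collect_eq open_Collect_const continuous_intros)
  ultimately show ?thesis by (simp add: compact_eq_bounded_closed)
qed

text \<open>A unit vector has a nonzero entry, which here must have its index in
  \<open>I1 L\<close>; dividing by it reaches the basis vector. This is the point of the support at
  which polynomials are tested below.\<close>

lemma scale_closure_axis:
  assumes "\<kappa> \<in> scale_closure"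
  obtains i w where "i \<in> I1 L" "\<kappa> * w = axis i 1"
proof -
  have "\<kappa> \<noteq> 0" using assms by (auto simp: scale_closure_def)
  then obtain i where i: "\<kappa> $ i \<noteq> 0" by (auto simp: vec_eq_iff)
  then have "i \<in> I1 L" using assms by (auto simp: scale_closure_def)
  moreover have "\<kappa> * axis i (1 / \<kappa> $ i) = axis i 1"
    using i by (simp add: vec_eq_iff axis_def)
  ultimately show thesis by (rule that)
qed

lemma AE_closure_D:
  assumes "\<kappa> \<in> scale_closure"
  shows "AE z in std_gaussian. D (\<kappa> * z) \<noteq> 0"
proof -
  obtain i w where "i \<in> I1 L" "\<kappa> * w = axis i 1"
    using assms by (rule scale_closure_axis)
  then show ?thesis
    by (intro AE_std_gaussian_polynomial[OF polynomial_D, of \<kappa> w]) (simp add: D_axis)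
qed

lemma polynomial_level: "real_polynomial_function (\<lambda>w. N w - C * D w)"
  using polynomial_N polynomial_D
  by (intro real_polynomial_function_diff real_polynomial_function.intros(2,4))

lemma AE_closure_level:
  assumes "\<kappa> \<in> scale_closure" "C > axis_max"
  shows "AE z in std_gaussian. g (\<kappa> * z) \<noteq> C"
proof -
  obtain i w where i: "i \<in> I1 L" "\<kappa> * w = axis i 1"
    using assms(1) by (rule scale_closure_axis)
  have "g (axis i 1) \<le> axis_max"
    unfolding axis_max_def using i(1) by (intro Max_ge) auto
  \<comment> \<open>Equality would mean \<open>g (axis i 1) = C\<close>, although \<open>C\<close>
    lies above \<open>axis_max\<close>.\<close>
  then have "N (axis i 1) - C * D (axis i 1) \<noteq> 0"
    using assms(2) D_axis[OF i(1)] by (auto simp: g_eq field_simps)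
  then have "AE z in std_gaussian. N (\<kappa> * z) - C * D (\<kappa> * z) \<noteq> 0"
    by (intro AE_std_gaussian_polynomial[OF polynomial_level, where w = w]) (simp add: i)
  with AE_closure_D[OF assms(1)] show ?thesis
    by eventually_elim (auto simp: g_eq)
qed

lemma scale_preimage:
  fixes \<tau> :: "real^'n"
  assumes "\<And>i. \<tau> $ i > 0"
  shows "\<tau> * (\<chi> i. w $ i / \<tau> $ i) = w"
  using assms by (simp add: vec_eq_iff less_imp_neq[THEN not_sym])

lemma AE_pos_D:
  assumes "\<And>i. \<tau> $ i > 0"
  shows "AE z in std_gaussian. D (\<tau> * z) \<noteq> 0"
proof -
  obtain w where "D w \<noteq> 0" using nonconstant by blast
  then show ?thesis
    by (intro AE_std_gaussian_polynomial[OF polynomial_D, of \<tau> "\<chi> i. w $ i / \<tau> $ i"])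
       (simp add: scale_preimage[OF assms])
qed

text \<open>Positive scales make the map from \<open>z\<close> to \<open>\<tau> * z\<close> onto, so
  any point where \<open>N - C * D\<close> is nonzero will do.\<close>

lemma AE_pos_level:
  assumes "\<And>i. \<tau> $ i > 0"
  shows "AE z in std_gaussian. g (\<tau> * z) \<noteq> C"
proof -
  \<comment> \<open>Of two points with different values of \<open>g\<close>, at least one misses the
    level \<open>C\<close>.\<close>
  obtain w where w: "D w \<noteq> 0" "g w \<noteq> C" using nonconstant by metis
  then have "N w - C * D w \<noteq> 0" by (auto simp: g_eq)
  then have "AE z in std_gaussian. N (\<tau> * z) - C * D (\<tau> * z) \<noteq> 0"
    by (intro AE_std_gaussian_polynomial[OF polynomial_level, where w = "\<chi> i. w $ i / \<tau> $ i"])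
       (simp add: scale_preimage[OF assms])
  with AE_pos_D[OF assms] show ?thesis
    by eventually_elim (auto simp: g_eq)
qed

section \<open>Limits of exceedance probabilities\<close>

lemma tendsto_g_scales:
  assumes "\<tau>s \<longlonglongrightarrow> \<tau>" "D (\<tau> * z) \<noteq> 0"
  shows "(\<lambda>m. g (\<tau>s m * z)) \<longlonglongrightarrow> g (\<tau> * z)"
proof -
  have "(\<lambda>m. \<tau>s m * z) \<longlonglongrightarrow> \<tau> * z"
  proof (rule vec_tendstoI)
    fix i
    show "(\<lambda>m. (\<tau>s m * z) $ i) \<longlonglongrightarrow> (\<tau> * z) $ i"
      using tendsto_vec_nth[OF assms(1), of i] by (simp add: tendsto_intros)
  qed
  then show ?thesis using isCont_g[OF assms(2)] by (rule isCont_tendsto_compose[rotated])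
qed

text \<open>Dominated convergence for the indicators of the exceedance events, with bound 1.\<close>

lemma exceed_prob_tendsto_AE:
  assumes "AE z in std_gaussian. \<forall>\<^sub>F m in sequentially. g (\<tau>s m * z) \<ge> Cs m \<longleftrightarrow> z \<in> A"
    and [measurable]: "A \<in> sets borel"
  shows "(\<lambda>m. exceed_prob g (\<tau>s m) (Cs m)) \<longlonglongrightarrow> measure std_gaussian A"
proof -
  interpret prob_space "std_gaussian :: (real^'n) measure" by (rule prob_space_std_gaussian)
  have "(\<lambda>m. \<integral>z. indicator {z. g (\<tau>s m * z) \<ge> Cs m} z \<partial>std_gaussian)
      \<longlonglongrightarrow> (\<integral>z. indicator A z \<partial>(std_gaussian :: (real^'n) measure) :: real)"
  proof (rule integral_dominated_convergence[where w = "\<lambda>_. 1"])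
    show "AE z in std_gaussian. (\<lambda>m. indicator {z. g (\<tau>s m * z) \<ge> Cs m} z :: real) \<longlonglongrightarrow> indicator A z"
      using assms(1)
    proof eventually_elim
      case (elim z)
      then have "\<forall>\<^sub>F m in sequentially. indicator {z. g (\<tau>s m * z) \<ge> Cs m} z = (indicator A z :: real)"
        by eventually_elim (auto simp: indicator_def)
      then show ?case by (rule tendsto_eventually)
    qed
  qed (auto simp: indicator_def)
  then show ?thesis by (simp add: exceed_prob_def)
qed

text \<open>Almost surely \<open>g - C\<close> is nonzero in the limit, and its strict sign persists
  for nearby scales and thresholds.\<close>

lemma exceed_prob_tendsto:
  assumes \<tau>s: "\<tau>s \<longlonglongrightarrow> \<tau>" and Cs: "Cs \<longlonglongrightarrow> C"
    and AE: "AE z in std_gaussian. D (\<tau> * z) \<noteq> 0" "AE z in std_gaussian. g (\<tau> * z) \<noteq> C"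
  shows "(\<lambda>m. exceed_prob g (\<tau>s m) (Cs m)) \<longlonglongrightarrow> exceed_prob g \<tau> C"
  unfolding exceed_prob_def[of _ \<tau>]
proof (rule exceed_prob_tendsto_AE)
  show "AE z in std_gaussian. \<forall>\<^sub>F m in sequentially.
      g (\<tau>s m * z) \<ge> Cs m \<longleftrightarrow> z \<in> {z. g (\<tau> * z) \<ge> C}"
    using AE
  proof eventually_elim
    case (elim z)
    have lim: "(\<lambda>m. g (\<tau>s m * z) - Cs m) \<longlonglongrightarrow> g (\<tau> * z) - C"
      by (intro tendsto_diff tendsto_g_scales \<tau>s Cs elim)
    consider "g (\<tau> * z) - C > 0" | "g (\<tau> * z) - C < 0" using elim by linarith
    then show ?case
    proof cases
      case 1
      from order_tendstoD(1)[OF lim this] show ?thesis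
        by eventually_elim (use 1 in auto)
    next
      case 2
      from order_tendstoD(2)[OF lim this] show ?thesis
        by eventually_elim (use 2 in auto)
    qed
  qed
qed measurable

text \<open>For almost every \<open>z\<close> the statistic converges to a finite value, which the
  thresholds eventually pass.\<close>

lemma exceed_prob_tendsto_0:
  assumes \<tau>s: "\<tau>s \<longlonglongrightarrow> \<tau>" and Cs: "filterlim Cs at_top sequentially"
    and AE: "AE z in std_gaussian. D (\<tau> * z) \<noteq> 0"
  shows "(\<lambda>m. exceed_prob g (\<tau>s m) (Cs m)) \<longlonglongrightarrow> 0"
proof -
  have "(\<lambda>m. exceed_prob g (\<tau>s m) (Cs m)) \<longlonglongrightarrow> measure (std_gaussian :: (real^'n) measure) {}"
  proof (rule exceed_prob_tendsto_AE)
    show "AE z in std_gaussian. \<forall>\<^sub>F m in sequentially. g (\<tau>s m * z) \<ge> Cs m \<longleftrightarrow> z \<in> {}"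
      using AE
    proof eventually_elim
      case (elim z)
      have "\<forall>\<^sub>F m in sequentially. g (\<tau>s m * z) < g (\<tau> * z) + 1"
        by (rule order_tendstoD(2)[OF tendsto_g_scales[OF \<tau>s elim]]) simp
      moreover have "\<forall>\<^sub>F m in sequentially. Cs m \<ge> g (\<tau> * z) + 1"
        using Cs by (simp add: filterlim_at_top)
      ultimately show ?case by eventually_elim auto
    qed
  qed simp
  then show ?thesis by simp
qed

text \<open>Values of \<open>g\<close> are finite, so thresholds falling to minus infinity are
  eventually met. This bounds the valid critical values from below.\<close>

lemma exceed_prob_tendsto_1: "(\<lambda>m. exceed_prob g \<tau> (- real m)) \<longlonglongrightarrow> 1"
proof -
  interpret prob_space "std_gaussian :: (real^'n) measure" by (rule prob_space_std_gaussian)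
  have "(\<lambda>m. exceed_prob g \<tau> (- real m)) \<longlonglongrightarrow> measure (std_gaussian :: (real^'n) measure) UNIV"
  proof (rule exceed_prob_tendsto_AE, rule AE_I2)
    fix z :: "real^'n"
    obtain m0 where m0: "- g (\<tau> * z) \<le> real m0" using real_arch_simple by blast
    show "\<forall>\<^sub>F m in sequentially. (- real m \<le> g (\<tau> * z)) = (z \<in> UNIV)"
      using eventually_ge_at_top[of m0]
    proof eventually_elim
      case (elim m)
      then have "real m0 \<le> real m" by simp
      then show ?case using m0 by simp
    qed
  qed simp
  then show ?thesis using prob_space by simp
qed

section \<open>Critical values\<close>

lemma exceed_prob_antimono:
  assumes "C \<le> C'" shows "exceed_prob g \<tau> C' \<le> exceed_prob g \<tau> C"
proof -
  interpret prob_space "std_gaussian :: (real^'n) measure" by (rule prob_space_std_gaussian)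
  show ?thesis
    unfolding exceed_prob_def using assms by (intro finite_measure_mono) auto
qed

lemma max_exceed_prob_antimono:
  assumes "C \<le> C'" shows "max_exceed_prob g C' \<le> max_exceed_prob g C"
  unfolding max_exceed_prob_def
  by (rule cSUP_mono[OF unit_scales_nonempty bdd_above_exceed_prob])
     (use exceed_prob_antimono[OF assms] in blast)

lemma max_exceed_prob_small:
  assumes "\<alpha> > 0"
  shows "\<exists>C. max_exceed_prob g C \<le> \<alpha>"
proof (rule ccontr)
  assume "\<nexists>C. max_exceed_prob g C \<le> \<alpha>"
  then have "\<exists>\<kappa>\<in>scale_closure. \<alpha> < exceed_prob g \<kappa> (real m)" for m
    by (meson less_max_exceed_prob not_le)
  then obtain \<kappa> where \<kappa>: "\<And>m. \<kappa> m \<in> scale_closure" "\<And>m. \<alpha> < exceed_prob g (\<kappa> m) (real m)"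
    by metis
  \<comment> \<open>Scales that violate the bound at the thresholds \<open>m\<close> accumulate at
    some \<open>l\<close>; along the subsequence the thresholds still diverge, so the probabilities
    must tend to 0.\<close>
  obtain l \<rho> where l: "l \<in> scale_closure" "strict_mono \<rho>" "(\<kappa> \<circ> \<rho>) \<longlonglongrightarrow> l"
    using compact_scale_closure \<kappa>(1) unfolding compact_def by metis
  have "filterlim (\<lambda>m. real (\<rho> m)) at_top sequentially"
    using filterlim_compose[OF filterlim_real_sequentially filterlim_subseq[OF l(2)]] .
  from exceed_prob_tendsto_0[OF l(3) this AE_closure_D[OF l(1)]]
  have "(\<lambda>m. exceed_prob g (\<kappa> (\<rho> m)) (real (\<rho> m))) \<longlonglongrightarrow> 0" by simp
  then have "\<alpha> \<le> 0"
    using \<kappa>(2) by (intro LIMSEQ_le_const) (auto intro: less_imp_le)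
  then show False using assms by simp
qed

text \<open>Adding a small positive constant to every entry approximates \<kappa> by positive
  vectors. These are not of norm 1, but \<open>exceed_prob_le_max\<close> covers all positive
  scales.\<close>

lemma exceed_prob_closure_le_max:
  assumes \<kappa>: "\<kappa> \<in> scale_closure" and C: "C > axis_max"
  shows "exceed_prob g \<kappa> C \<le> max_exceed_prob g C"
proof (rule LIMSEQ_le_const2)
  let ?\<tau> = "\<lambda>m. \<kappa> + (1 / real (Suc m)) *\<^sub>R (\<chi> i. 1)"
  have "?\<tau> \<longlonglongrightarrow> \<kappa> + 0 *\<^sub>R (\<chi> i. 1)"
    by (intro tendsto_intros LIMSEQ_Suc[OF lim_1_over_n])
  then have "?\<tau> \<longlonglongrightarrow> \<kappa>" by simp
  then show "(\<lambda>m. exceed_prob g (?\<tau> m) C) \<longlonglongrightarrow> exceed_prob g \<kappa> C"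
    by (rule exceed_prob_tendsto[OF _ tendsto_const AE_closure_D[OF \<kappa>] AE_closure_level[OF \<kappa> C]])
  have "exceed_prob g (?\<tau> m) C \<le> max_exceed_prob g C" for m
    using \<kappa> by (intro exceed_prob_le_max) (simp add: scale_closure_def add_nonneg_pos)
  then show "\<exists>m0. \<forall>m\<ge>m0. exceed_prob g (?\<tau> m) C \<le> max_exceed_prob g C" by blast
qed

text \<open>The valid critical values form a nonempty set that is bounded below and closed upwards;
  it remains to see that it contains its infimum.\<close>

lemma smallest_critical_value_exists:
  assumes "0 < \<alpha>" "\<alpha> < 1"
  obtains C where "is_smallest C {C. max_exceed_prob g C \<le> \<alpha>}"
proof -
  let ?S = "{C. max_exceed_prob g C \<le> \<alpha>}"
  have ne: "?S \<noteq> {}" using max_exceed_prob_small[OF assms(1)] by blast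
  have bdd: "bdd_below ?S"
  proof -
    let ?o = "(\<chi> i. 1) :: real^'n"
    \<comment> \<open>Here \<open>\<alpha> < 1\<close> enters: very negative thresholds are exceeded
      with probability above \<alpha>, already for the scale vector of ones.\<close>
    have "\<forall>\<^sub>F m in sequentially. exceed_prob g ?o (- real m) > \<alpha>"
      using order_tendstoD(1)[OF exceed_prob_tendsto_1 assms(2)] .
    then obtain m where "exceed_prob g ?o (- real m) > \<alpha>"
      by (auto simp: eventually_sequentially)
    moreover have "exceed_prob g ?o (- real m) \<le> max_exceed_prob g (- real m)"
      by (rule exceed_prob_le_max) simp
    ultimately have m: "max_exceed_prob g (- real m) > \<alpha>" by simp
    have "- real m \<le> C" if "max_exceed_prob g C \<le> \<alpha>" for C
      using max_exceed_prob_antimono[of C "- real m"] m that by linarith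
    then show ?thesis by (auto simp: bdd_below_def)
  qed
  have above: "max_exceed_prob g C \<le> \<alpha>" if C: "C > Inf ?S" for C
  proof -
    obtain C' where "C' \<in> ?S" "C' < C" using C cInf_less_iff[OF ne bdd] by blast
    then show ?thesis using max_exceed_prob_antimono[of C' C] by simp
  qed
  \<comment> \<open>For each fixed \<tau> the level \<open>Inf ?S\<close> carries no atom, so the
    bound passes to the limit as the thresholds decrease to it; the supremum over \<tau> is taken
    afterwards.\<close>
  have "exceed_prob g \<tau> (Inf ?S) \<le> \<alpha>" if "\<tau> \<in> unit_scales" for \<tau>
  proof -
    have \<tau>: "\<And>i. \<tau> $ i > 0" using that by (simp add: unit_scales_def)
    let ?C = "\<lambda>m. Inf ?S + 1 / real (Suc m)"
    have "?C \<longlonglongrightarrow> Inf ?S + 0"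
      by (intro tendsto_intros LIMSEQ_Suc[OF lim_1_over_n])
    then have "(\<lambda>m. exceed_prob g \<tau> (?C m)) \<longlonglongrightarrow> exceed_prob g \<tau> (Inf ?S)"
      by (intro exceed_prob_tendsto tendsto_const AE_pos_D AE_pos_level \<tau>) simp
    moreover have "exceed_prob g \<tau> (?C m) \<le> \<alpha>" for m
      using exceed_prob_le_max[OF \<tau>, of "?C m"] above[of "?C m"] by simp
    ultimately show ?thesis by (intro LIMSEQ_le_const2) auto
  qed
  then have "Inf ?S \<in> ?S"
    using unit_scales_nonempty by (auto simp: max_exceed_prob_def intro: cSUP_least)
  then have "is_smallest (Inf ?S) ?S"
    using cInf_lower[OF _ bdd] by (auto simp: is_smallest_def)
  then show thesis by (rule that)
qed

lemma smallest_critical_value_exact: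
  assumes smallest: "is_smallest C {C. max_exceed_prob g C \<le> \<alpha>}"
    and \<alpha>: "\<alpha> \<le> (SUP C\<in>{axis_max<..}. max_exceed_prob g C)"
  shows "max_exceed_prob g C = \<alpha>"
proof (rule antisym)
  show "max_exceed_prob g C \<le> \<alpha>" using smallest by (simp add: is_smallest_def)
  show "\<alpha> \<le> max_exceed_prob g C"
  proof (cases "C \<le> axis_max")
    case True
    \<comment> \<open>Every level above \<open>axis_max\<close> is also at least \<open>C\<close>,
      so monotonicity bounds the whole supremum.\<close>
    then have "(SUP C\<in>{axis_max<..}. max_exceed_prob g C) \<le> max_exceed_prob g C"
      by (intro cSUP_least max_exceed_prob_antimono) auto
    with \<alpha> show ?thesis by simp
  next
    case False
    \<comment> \<open>By minimality no level below \<open>C\<close> is valid. Scales witnessing this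
      accumulate at some \<open>l\<close>, possibly with zero entries; as \<open>C\<close> exceeds
      \<open>axis_max\<close>, the probabilities converge to that of \<open>l\<close> at
      \<open>C\<close>.\<close>
    have "\<alpha> < max_exceed_prob g (C - 1 / real (Suc m))" for m
      using smallest by (force simp: is_smallest_def not_le[symmetric])
    then have "\<exists>\<kappa>\<in>scale_closure. \<alpha> < exceed_prob g \<kappa> (C - 1 / real (Suc m))" for m
      by (meson less_max_exceed_prob)
    then obtain \<kappa> where \<kappa>: "\<And>m. \<kappa> m \<in> scale_closure"
        "\<And>m. \<alpha> < exceed_prob g (\<kappa> m) (C - 1 / real (Suc m))"
      by metis
    obtain l \<rho> where l: "l \<in> scale_closure" "strict_mono \<rho>" "(\<kappa> \<circ> \<rho>) \<longlonglongrightarrow> l"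
      using compact_scale_closure \<kappa>(1) unfolding compact_def by metis
    have "(\<lambda>m. C - 1 / real (Suc m)) \<longlonglongrightarrow> C - 0"
      by (intro tendsto_intros LIMSEQ_Suc[OF lim_1_over_n])
    then have "((\<lambda>m. C - 1 / real (Suc m)) \<circ> \<rho>) \<longlonglongrightarrow> C"
      by (intro LIMSEQ_subseq_LIMSEQ l) simp
    from exceed_prob_tendsto[OF l(3) this AE_closure_D[OF l(1)] AE_closure_level[OF l(1)]] False
    have "(\<lambda>m. exceed_prob g (\<kappa> (\<rho> m)) (C - 1 / real (Suc (\<rho> m)))) \<longlonglongrightarrow> exceed_prob g l C"
      by simp
    then have "\<alpha> \<le> exceed_prob g l C"
      using \<kappa>(2) by (intro LIMSEQ_le_const) (auto intro: less_imp_le)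
    also have "\<dots> \<le> max_exceed_prob g C"
      using exceed_prob_closure_le_max[OF l(1)] False by simp
    finally show ?thesis .
  qed
qed

end

subsection \<open>Quadratic form statistics and the size of tests\<close>

lemma matrix_mul_matrix_inv:
  fixes A :: "real^'n^'n"
  assumes "det A \<noteq> 0"
  shows "A ** matrix_inv A = mat 1"
proof -
  obtain B where "A ** B = mat 1"
    using assms invertible_det_nz[of A] by (auto simp: invertible_def)
  then show ?thesis using matrix_inv_eqI by metis
qed

lemma matrix_inv_scaleR:
  fixes A :: "real^'n^'n"
  assumes "c \<noteq> 0" "det A \<noteq> 0"
  shows "matrix_inv (c *\<^sub>R A) = (1 / c) *\<^sub>R matrix_inv A"
  using assms matrix_mul_matrix_inv[OF assms(2)]
  by (intro matrix_inv_eqI) (simp add: scalar_matrix_assoc matrix_scalar_ac)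

text \<open>Nonvanishing is read off from the explicit inverse
  \<open>(1 / b) *\<^sub>R matrix_inv B\<close>, since determinants multiply.\<close>

lemma det_scaleR_nonzero_iff:
  fixes A :: "real^'n^'n"
  assumes "c \<noteq> 0"
  shows "det (c *\<^sub>R A) \<noteq> 0 \<longleftrightarrow> det A \<noteq> 0"
proof -
  have *: "det (b *\<^sub>R B) \<noteq> 0" if "b \<noteq> 0" "det B \<noteq> 0" for b and B :: "real^'n^'n"
  proof -
    have "(b *\<^sub>R B) ** ((1 / b) *\<^sub>R matrix_inv B) = mat 1"
      using that matrix_mul_matrix_inv[OF that(2)] by (simp add: scalar_matrix_assoc matrix_scalar_ac)
    then have "det (b *\<^sub>R B) * det ((1 / b) *\<^sub>R matrix_inv B) = 1"
      by (metis det_I det_mul)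
    then show ?thesis by auto
  qed
  have "(1 / c) *\<^sub>R (c *\<^sub>R A) = A" using assms by simp
  then show ?thesis using assms *[of c A] *[of "1 / c" "c *\<^sub>R A"] by auto
qed

lemma det_nonzero_if_trivial_kernel:
  fixes A :: "real^'n^'n"
  assumes "\<And>x. A *v x = 0 \<Longrightarrow> x = 0"
  shows "det A \<noteq> 0"
  using assms matrix_left_invertible_ker[of A] invertible_left_inverse[of A] invertible_det_nz[of A]
  by blast

lemma real_polynomial_function_det:
  fixes A :: "'a::real_normed_vector \<Rightarrow> real^'n^'n"
  assumes "\<And>i j. real_polynomial_function (\<lambda>w. A w $ i $ j)"
  shows "real_polynomial_function (\<lambda>w. det (A w))"
  unfolding det_def
  by (intro real_polynomial_function_sum real_polynomial_function.intros(2,4)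
      real_polynomial_function_prod assms) (simp_all add: finite_permutations)

text \<open>The quadratic form of the adjugate of \<open>A\<close> at \<open>v\<close>, written
  through Cramer's rule: column \<open>k\<close> is replaced by \<open>v\<close>. It is polynomial
  in the entries of \<open>A\<close> and \<open>v\<close>, whether or not \<open>A\<close> is
  singular.\<close>

definition cramer_num :: "real^'n^'n \<Rightarrow> real^'n \<Rightarrow> real" where
  "cramer_num A v = (\<Sum>k\<in>UNIV. v $ k * det (\<chi> i j. if j = k then v $ i else A $ i $ j))"

lemma inner_matrix_inv_cramer:
  assumes "det A \<noteq> 0"
  shows "v \<bullet> (matrix_inv A *v v) = cramer_num A v / det A"
proof -
  have "A *v (matrix_inv A *v v) = v"
    using matrix_mul_matrix_inv[OF assms] by (simp only: matrix_vector_mul_assoc matrix_vector_mul_lid)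
  then have "matrix_inv A *v v = (\<chi> k. det (\<chi> i j. if j = k then v $ i else A $ i $ j) / det A)"
    using cramer[OF assms] by blast
  then show ?thesis
    by (simp add: inner_vec_def cramer_num_def sum_divide_distrib)
qed

text \<open>With \<open>v\<close> of degree 1 and \<open>M\<close> of degree 2, the quadratic form
  of the inverse has degree 0. Cramer's rule supplies the two polynomials.\<close>

lemma homogeneous_ratio_quadratic_form:
  fixes v :: "real^'n \<Rightarrow> real^'q" and M :: "real^'n \<Rightarrow> real^'q^'q"
  assumes v: "bounded_linear v"
    and M: "\<And>i j. real_polynomial_function (\<lambda>w. M w $ i $ j)"
    and M_scale: "\<And>c w. M (c *\<^sub>R w) = c\<^sup>2 *\<^sub>R M w"
    and L: "subspace L" "I1 L \<noteq> {}"
    and v_L: "\<And>l. l \<in> L \<Longrightarrow> v l = 0"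
    and M_shift: "\<And>l w. l \<in> L \<Longrightarrow> M (w + l) = M w"
    and M_axis: "\<And>i. i \<in> I1 L \<Longrightarrow> det (M (axis i 1)) \<noteq> 0"
    and g: "\<And>w. g w = (if det (M w) \<noteq> 0 then v w \<bullet> (matrix_inv (M w) *v v w) else 0)"
    and nonconst: "det (M w1) \<noteq> 0" "det (M w2) \<noteq> 0" "g w1 \<noteq> g w2"
  shows "homogeneous_ratio (\<lambda>w. cramer_num (M w) (v w)) (\<lambda>w. det (M w)) g L"
proof
  have vi: "real_polynomial_function (\<lambda>w. v w $ i)" for i
    by (intro real_polynomial_function.intros(1) bounded_linear_compose[OF bounded_linear_vec_nth v])
  have "real_polynomial_function (\<lambda>w. if j = k then v w $ i else M w $ i $ j)" for i j k
    using vi M by (cases "j = k") simp_all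
  then show "real_polynomial_function (\<lambda>w. cramer_num (M w) (v w))"
    unfolding cramer_num_def
    by (intro real_polynomial_function_sum real_polynomial_function.intros(4)
        real_polynomial_function_det vi) simp_all
  show "real_polynomial_function (\<lambda>w. det (M w))"
    using M by (rule real_polynomial_function_det)
  \<comment> \<open>Where the determinant vanishes both sides are 0, the right one by division by
    zero.\<close>
  show "g w = cramer_num (M w) (v w) / det (M w)" for w
    by (simp add: g inner_matrix_inv_cramer)
  show "g (c *\<^sub>R w) = g w" if "c \<noteq> 0" for c w
  proof -
    have c: "c\<^sup>2 \<noteq> 0" using that by simp
    have "v (c *\<^sub>R w) = c *\<^sub>R v w" using v by (simp add: bounded_linear.linear linear_scale)
    moreover have "(c *\<^sub>R x) \<bullet> (((1 / c\<^sup>2) *\<^sub>R B) *v (c *\<^sub>R x)) = x \<bullet> (B *v x)"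
      for x :: "real^'q" and B :: "real^'q^'q"
      using that
      by (simp add: matrix_vector_mult_scaleR scaleR_matrix_vector_assoc[symmetric] power2_eq_square)
    ultimately show ?thesis
      by (cases "det (M w) = 0")
         (simp_all only: g M_scale det_scaleR_nonzero_iff[OF c] matrix_inv_scaleR[OF c] if_True if_False simp_thms)
  qed
  show "g (w + l) = g w" if "l \<in> L" for l w
  proof -
    have "v (w + l) = v w" using v v_L[OF that] by (simp add: bounded_linear.linear linear_add)
    then show ?thesis using M_shift[OF that] by (simp add: g)
  qed
  show "\<exists>w1 w2. det (M w1) \<noteq> 0 \<and> det (M w2) \<noteq> 0 \<and> g w1 \<noteq> g w2"
    using nonconst by blast
qed (use L M_axis in auto)

section \<open>Sizes as maximal exceedance probabilities\<close>

lemma C_Het_eq: "C_Het = (\<lambda>\<tau>. diag (\<chi> i. (\<tau> $ i)\<^sup>2)) ` (unit_scales :: (real^'n) set)"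
proof -
  have norm1: "norm \<tau> = 1 \<longleftrightarrow> (\<Sum>i\<in>UNIV. (\<tau> $ i)\<^sup>2) = 1" for \<tau> :: "real^'n"
    by (simp add: norm_eq_1 inner_vec_def power2_eq_square)
  show ?thesis
  proof (intro set_eqI iffI)
    fix S :: "real^'n^'n" assume "S \<in> C_Het"
    then obtain \<tau> where \<tau>: "S = diag (\<chi> i. (\<tau> i)\<^sup>2)" "\<And>i. (\<tau> i)\<^sup>2 > 0" "(\<Sum>i\<in>UNIV. (\<tau> i)\<^sup>2) = 1"
      by (auto simp: C_Het_def)
    \<comment> \<open>Only the squares of \<tau> matter, so signs are removed to obtain positive
      entries.\<close>
    then have "(\<chi> i. \<bar>\<tau> i\<bar>) \<in> unit_scales"
      by (simp add: unit_scales_def norm1)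
    moreover have "S = diag (\<chi> i. ((\<chi> i. \<bar>\<tau> i\<bar>) $ i)\<^sup>2)"
      using \<tau>(1) by simp
    ultimately show "S \<in> (\<lambda>\<tau>. diag (\<chi> i. (\<tau> $ i)\<^sup>2)) ` unit_scales" by blast
  next
    fix S :: "real^'n^'n" assume "S \<in> (\<lambda>\<tau>. diag (\<chi> i. (\<tau> $ i)\<^sup>2)) ` unit_scales"
    then obtain \<tau> where \<tau>: "S = diag (\<chi> i. (\<tau> $ i)\<^sup>2)" "\<tau> \<in> unit_scales" by blast
    then have "(\<forall>i. (\<tau> $ i)\<^sup>2 > 0) \<and> (\<Sum>i\<in>UNIV. (\<tau> $ i)\<^sup>2) = 1"
      by (simp add: unit_scales_def norm1 less_imp_neq[THEN not_sym])
    with \<tau>(1) show "S \<in> C_Het" unfolding C_Het_def by blast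
  qed
qed

text \<open>\<open>T_eq\<close> uses the same \<open>g\<close> for every \<mu> in \<open>M0\<close>;
  this is why neither the size nor \<open>C*\<close> and \<open>\<alpha>*\<close> depend on the
  chosen point.\<close>

locale invariant_test = homogeneous_ratio N D g "M0_lin X R"
  for N D g :: "real^'n \<Rightarrow> real" and X :: "real^'k^'n" and R :: "real^'k^'q" +
  fixes r :: "real^'q" and T :: "real^'n \<Rightarrow> real"
  assumes T_eq: "\<mu> \<in> M0 X R r \<Longrightarrow> T (\<mu> + w) = g w"
    and M0_nonempty: "M0 X R r \<noteq> {}"
begin

text \<open>The factor \<open>sqrt \<sigma>2\<close> is absorbed into the scales and then removed by
  homogeneity of degree 0.\<close>

lemma measure_gaussian_exceed:
  assumes \<mu>: "\<mu> \<in> M0 X R r" and "\<sigma>2 > 0" and \<tau>: "\<And>i. \<tau> $ i > 0"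
  shows "measure (gaussian_measure \<mu> (\<sigma>2 *\<^sub>R diag (\<chi> i. (\<tau> $ i)\<^sup>2))) {y. T y \<ge> C} = exceed_prob g \<tau> C"
proof -
  let ?a = "sqrt \<sigma>2 *\<^sub>R \<tau>"
  have "\<sigma>2 *\<^sub>R diag (\<chi> i. (\<tau> $ i)\<^sup>2) = diag (\<chi> i. (?a $ i)\<^sup>2)"
    using assms(2) by (simp add: diag_def vec_eq_iff power_mult_distrib)
  moreover have "gaussian_measure \<mu> (diag (\<chi> i. (?a $ i)\<^sup>2)) = distr std_gaussian borel (\<lambda>z. \<mu> + ?a * z)"
    using assms by (intro gaussian_measure_diag_eq_distr) simp
  ultimately have eq: "gaussian_measure \<mu> (\<sigma>2 *\<^sub>R diag (\<chi> i. (\<tau> $ i)\<^sup>2))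
      = distr std_gaussian borel (\<lambda>z. \<mu> + ?a * z)" by simp
  have "T y = g (y - \<mu>)" for y
    using T_eq[OF \<mu>, of "y - \<mu>"] by simp
  then have T: "T = (\<lambda>y. g (y - \<mu>))" by blast
  have [measurable]: "{y. T y \<ge> C} \<in> sets borel"
    unfolding T by measurable
  have "measure (distr std_gaussian borel (\<lambda>z. \<mu> + ?a * z)) {y. T y \<ge> C}
      = measure std_gaussian {z. T (\<mu> + ?a * z) \<ge> C}"
    by (subst measure_distr) (auto simp: vimage_def)
  also have "\<dots> = exceed_prob g ?a C"
    by (simp only: T_eq[OF \<mu>] exceed_prob_def)
  also have "\<dots> = exceed_prob g \<tau> C"
    using assms(2) by (intro exceed_prob_scale) simp
  finally show ?thesis by (simp only: eq)
qed

lemma SUP_C_Het: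
  assumes "\<mu> \<in> M0 X R r" "\<sigma>2 > 0"
  shows "(SUP \<Sigma>\<in>C_Het. measure (gaussian_measure \<mu> (\<sigma>2 *\<^sub>R \<Sigma>)) {y. T y \<ge> C}) = max_exceed_prob g C"
  unfolding C_Het_eq image_image max_exceed_prob_def
  by (rule SUP_cong[OF refl]) (simp add: measure_gaussian_exceed[OF assms] unit_scales_def)

lemma test_size_eq: "test_size X R r T C = max_exceed_prob g C"
proof -
  have "test_size X R r T C = (SUP \<mu>0\<in>M0 X R r. SUP \<sigma>2\<in>{0::real<..}. max_exceed_prob g C)"
    unfolding test_size_def by (intro SUP_cong refl) (simp add: SUP_C_Het)
  then show ?thesis using M0_nonempty by simp
qed

lemma C_star_eq: "\<mu> \<in> M0 X R r \<Longrightarrow> C_star X R T \<mu> = axis_max"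
  by (simp add: C_star_def axis_max_def T_eq)

lemma alpha_star_eq:
  assumes "\<mu> \<in> M0 X R r"
  shows "alpha_star X R T \<mu> = (SUP C\<in>{axis_max<..}. max_exceed_prob g C)"
  unfolding alpha_star_def C_star_eq[OF assms]
  using SUP_C_Het[OF assms, of 1] by simp

lemma size_controllable: "\<forall>\<alpha>\<in>{0<..<1}. \<exists>C. test_size X R r T C \<le> \<alpha>"
  using max_exceed_prob_small by (simp add: test_size_eq)

lemma star_invariant:
  "\<forall>\<mu>0\<in>M0 X R r. \<forall>\<mu>1\<in>M0 X R r. C_star X R T \<mu>0 = C_star X R T \<mu>1
    \<and> alpha_star X R T \<mu>0 = alpha_star X R T \<mu>1"
  by (simp add: C_star_eq alpha_star_eq)

lemma exact_size:
  "\<forall>\<mu>0\<in>M0 X R r. \<forall>\<alpha>\<in>{0<..alpha_star X R T \<mu>0} \<inter> {0<..<1}. \<exists>C. test_size X R r T C = \<alpha>"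
proof (intro ballI)
  fix \<mu> \<alpha> assume *: "\<mu> \<in> M0 X R r" "\<alpha> \<in> {0<..alpha_star X R T \<mu>} \<inter> {0<..<1}"
  then obtain C where "is_smallest C {C. max_exceed_prob g C \<le> \<alpha>}"
    by (auto intro: smallest_critical_value_exists)
  with * show "\<exists>C. test_size X R r T C = \<alpha>"
    using smallest_critical_value_exact by (auto simp: test_size_eq alpha_star_eq)
qed

text \<open>If some \<open>C'\<close> has size \<alpha>, then the smallest valid \<open>C\<close> is
  at most \<open>C'\<close>, and monotonicity gives it size at least \<alpha>.\<close>

lemma smallest_critical_value:
  "\<forall>\<alpha>\<in>{0<..<1}. \<exists>C_min. is_smallest C_min {C. test_size X R r T C \<le> \<alpha>}
    \<and> ((\<exists>C. test_size X R r T C = \<alpha>) \<longrightarrow> is_smallest C_min {C. test_size X R r T C = \<alpha>})"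
proof
  fix \<alpha> :: real assume "\<alpha> \<in> {0<..<1}"
  then obtain C where C: "is_smallest C {C. max_exceed_prob g C \<le> \<alpha>}"
    by (auto intro: smallest_critical_value_exists)
  have "is_smallest C {C. max_exceed_prob g C = \<alpha>}" if C': "max_exceed_prob g C' = \<alpha>" for C'
  proof -
    have "\<alpha> \<le> max_exceed_prob g C"
      using C C' max_exceed_prob_antimono[of C C'] by (auto simp: is_smallest_def)
    then show ?thesis using C by (auto simp: is_smallest_def intro: antisym)
  qed
  with C show "\<exists>C_min. is_smallest C_min {C. test_size X R r T C \<le> \<alpha>}
    \<and> ((\<exists>C. test_size X R r T C = \<alpha>) \<longrightarrow> is_smallest C_min {C. test_size X R r T C = \<alpha>})"
    by (auto simp: test_size_eq)
qed

end

subsection \<open>The two test statistics\<close>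

lemma linear_orth_proj:
  fixes L :: "'a::euclidean_space set"
  assumes "subspace L"
  shows "linear (orth_proj L)"
proof (rule linearI)
  note p = orth_proj_exists[OF assms]
  fix x y show "orth_proj L (x + y) = orth_proj L x + orth_proj L y"
  proof (rule orth_proj_eqI[OF assms])
    show "orth_proj L x + orth_proj L y \<in> L" using p assms by (simp add: subspace_add)
    have "(x - orth_proj L x) + (y - orth_proj L y) \<in> L\<^sup>\<bottom>"
      using p by (intro subspace_add subspace_orthogonal_comp) auto
    then show "x + y - (orth_proj L x + orth_proj L y) \<in> L\<^sup>\<bottom>" by (simp add: algebra_simps)
  qed
next
  note p = orth_proj_exists[OF assms]
  fix c :: real and x show "orth_proj L (c *\<^sub>R x) = c *\<^sub>R orth_proj L x"
  proof (rule orth_proj_eqI[OF assms])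
    show "c *\<^sub>R orth_proj L x \<in> L" using p assms by (simp add: subspace_scale)
    have "c *\<^sub>R (x - orth_proj L x) \<in> L\<^sup>\<bottom>"
      using p by (intro subspace_scale subspace_orthogonal_comp) auto
    then show "c *\<^sub>R x - c *\<^sub>R orth_proj L x \<in> L\<^sup>\<bottom>" by (simp add: algebra_simps)
  qed
qed

lemma orth_proj_complement_eq_0_iff:
  fixes L :: "'a::euclidean_space set"
  assumes "subspace L"
  shows "orth_proj (L\<^sup>\<bottom>) y = 0 \<longleftrightarrow> y \<in> L"
proof
  assume "orth_proj (L\<^sup>\<bottom>) y = 0"
  then show "y \<in> L"
    using orth_proj_exists[OF subspace_orthogonal_comp, of L y] assms by (simp add: orthogonal_comp_self)
next
  assume "y \<in> L"
  then show "orth_proj (L\<^sup>\<bottom>) y = 0"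
    using assms by (intro orth_proj_eqI subspace_orthogonal_comp) (auto simp: orthogonal_comp_self subspace_0 subspace_orthogonal_comp)
qed

lemma inner_matrix_vector_mult: "x \<bullet> (A *v y) = (transpose A *v x) \<bullet> (y :: real^'n)"
  by (simp only: transpose_matrix_vector dot_lmul_matrix)

text \<open>A weighted sum of squares: with nonnegative weights the form vanishes only if each term
  does.\<close>

lemma inner_congruence_diag:
  fixes K :: "real^'n^'q"
  shows "x \<bullet> ((K ** diag e ** transpose K) *v x) = (\<Sum>i\<in>UNIV. e $ i * ((transpose K *v x) $ i)\<^sup>2)"
proof -
  have "x \<bullet> ((K ** diag e ** transpose K) *v x) = (transpose K *v x) \<bullet> (e * (transpose K *v x))"
    by (simp only: inner_matrix_vector_mult diag_mult_vec matrix_vector_mul_assoc[symmetric])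
  then show ?thesis
    by (simp only: inner_vec_def inner_real_def vector_mult_component) (simp add: power2_eq_square algebra_simps)
qed

section \<open>Linear algebra of the restricted regression model\<close>

locale restricted_regression =
  fixes X :: "real^'k^'n" and R :: "real^'k^'q" and r :: "real^'q"
  assumes k_less_n: "CARD('k) < CARD('n)"
    and rank_X: "rank X = CARD('k)"
    and rank_R: "rank R = CARD('q)"
begin

definition gram_inv :: "real^'k^'k" where
  "gram_inv = matrix_inv (transpose X ** X)"

text \<open>The matrix sending \<open>y\<close> to the estimate
  \<open>R *v beta_hat X y\<close>.\<close>

definition coef :: "real^'n^'q" where
  "coef = R ** gram_inv ** transpose X"

definition resid :: "real^'n \<Rightarrow> real^'n" where
  "resid = orth_proj ((M0_lin X R)\<^sup>\<bottom>)"

lemma X_kernel: "X *v b = 0 \<longleftrightarrow> b = 0"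
  using rank_X full_rank_injective[of X] by (auto simp: inj_def)

lemma R_surj: "\<exists>b. R *v b = c"
  using rank_R full_rank_surjective[of R] by (metis surjD)

lemma M0_ne: "M0 X R r \<noteq> {}"
  using R_surj[of r] by (auto simp: M0_def)

lemma det_gram: "det (transpose X ** X) \<noteq> 0"
proof (rule det_nonzero_if_trivial_kernel)
  fix b assume "(transpose X ** X) *v b = 0"
  then have "b \<bullet> (transpose X *v (X *v b)) = 0"
    by (simp only: matrix_vector_mul_assoc inner_zero_right)
  then have "(X *v b) \<bullet> (X *v b) = 0"
    by (simp only: inner_matrix_vector_mult transpose_transpose)
  then show "b = 0" by (simp add: X_kernel del: matrix_vector_mul_component)
qed

lemma gram_mul_inv: "transpose X ** X ** gram_inv = mat 1"
  unfolding gram_inv_def by (rule matrix_mul_matrix_inv[OF det_gram])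

lemma gram_inv_mul: "gram_inv ** (transpose X ** X) = mat 1"
  using gram_mul_inv by (simp add: matrix_left_right_inverse)

lemma transpose_gram_inv: "transpose gram_inv = gram_inv"
proof -
  have "transpose (gram_inv ** (transpose X ** X)) = mat 1"
    by (simp only: gram_inv_mul transpose_mat)
  then have "(transpose X ** X) ** transpose gram_inv = mat 1"
    by (simp only: matrix_transpose_mul transpose_transpose)
  then show ?thesis unfolding gram_inv_def by (metis matrix_inv_eqI)
qed

lemma transpose_coef: "transpose coef = X ** gram_inv ** transpose R"
  by (simp only: coef_def matrix_transpose_mul transpose_transpose transpose_gram_inv matrix_mul_assoc)

lemma coef_X: "coef ** X = R"
  using gram_inv_mul by (simp only: coef_def matrix_mul_assoc[symmetric] matrix_mul_rid)

lemma coef_transpose_coef: "coef ** transpose coef = R ** gram_inv ** transpose R"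
proof -
  have "coef ** transpose coef = (coef ** X) ** (gram_inv ** transpose R)"
    by (simp only: transpose_coef matrix_mul_assoc)
  then show ?thesis by (simp only: coef_X matrix_mul_assoc)
qed

text \<open>From \<open>coef ** X = R\<close> the kernel of the transpose of \<open>coef\<close>
  lies in that of the transpose of \<open>R\<close>, which is trivial because \<open>R\<close> is
  onto.\<close>

lemma transpose_coef_kernel: "transpose coef *v x = 0 \<Longrightarrow> x = 0"
proof -
  assume "transpose coef *v x = 0"
  then have "transpose X *v (transpose coef *v x) = 0" by simp
  then have "transpose (coef ** X) *v x = 0"
    by (simp only: matrix_transpose_mul matrix_vector_mul_assoc)
  then have *: "transpose R *v x = 0" by (simp only: coef_X)
  obtain b where "R *v b = x" using R_surj by blast
  then have "x \<bullet> x = (transpose R *v x) \<bullet> b"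
    using inner_matrix_vector_mult[of x R b] by simp
  with * show "x = 0" by simp
qed

lemma coef_L:
  assumes "l \<in> M0_lin X R"
  shows "coef *v l = 0"
proof -
  obtain b where "l = X *v b" "R *v b = 0" using assms by (auto simp: M0_lin_def)
  then show ?thesis by (simp only: matrix_vector_mul_assoc coef_X)
qed

text \<open>\<open>coef\<close> recovers \<open>R *v b\<close> from \<open>X *v b\<close>, so the
  part coming from \<mu> cancels \<open>r\<close>.\<close>

lemma restriction_deviation:
  assumes "\<mu> \<in> M0 X R r"
  shows "R *v beta_hat X (\<mu> + w) - r = coef *v w"
proof -
  obtain b where b: "\<mu> = X *v b" "R *v b = r" using assms by (auto simp: M0_def)
  have "R *v beta_hat X (\<mu> + w) = coef *v (\<mu> + w)"
    by (simp only: beta_hat_def coef_def gram_inv_def matrix_vector_mul_assoc matrix_mul_assoc)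
  also have "\<dots> = coef *v (X *v b) + coef *v w"
    by (simp only: b matrix_vector_right_distrib)
  also have "coef *v (X *v b) = r"
    by (simp only: matrix_vector_mul_assoc coef_X b)
  finally show ?thesis by simp
qed

lemma u_tilde_shift: "\<mu> \<in> M0 X R r \<Longrightarrow> u_tilde X R r (\<mu> + w) = resid w"
  by (simp add: u_tilde_eq resid_def)

lemma M0_shift_iff:
  assumes "\<mu> \<in> M0 X R r"
  shows "\<mu> + w \<in> M0 X R r \<longleftrightarrow> w \<in> M0_lin X R"
proof -
  obtain b where b: "\<mu> = X *v b" "R *v b = r" using assms by (auto simp: M0_def)
  show ?thesis
  proof
    assume "\<mu> + w \<in> M0 X R r"
    then obtain c where "\<mu> + w = X *v c" "R *v c = r" by (auto simp: M0_def)
    then have "w = X *v (c - b)" "R *v (c - b) = 0"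
      using b by (auto simp: matrix_vector_mult_diff_distrib algebra_simps)
    then show "w \<in> M0_lin X R" unfolding M0_lin_def by blast
  next
    assume "w \<in> M0_lin X R"
    then obtain c where "w = X *v c" "R *v c = 0" by (auto simp: M0_lin_def)
    then have "\<mu> + w = X *v (b + c)" "R *v (b + c) = r"
      using b by (simp_all add: matrix_vector_right_distrib)
    then show "\<mu> + w \<in> M0 X R r" unfolding M0_def by blast
  qed
qed

lemma bounded_linear_resid: "bounded_linear resid"
  unfolding resid_def
  by (intro linear_conv_bounded_linear[THEN iffD1] linear_orth_proj subspace_orthogonal_comp)

lemma resid_eq_0_iff: "resid w = 0 \<longleftrightarrow> w \<in> M0_lin X R"
  unfolding resid_def by (rule orth_proj_complement_eq_0_iff[OF subspace_M0_lin])

lemma resid_scale: "resid (c *\<^sub>R w) = c *\<^sub>R resid w"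
  using bounded_linear_resid by (simp add: bounded_linear.linear linear_scale)

lemma resid_shift: "l \<in> M0_lin X R \<Longrightarrow> resid (w + l) = resid w"
  using bounded_linear_resid resid_eq_0_iff[of l] by (simp add: bounded_linear.linear linear_add)

lemma polynomial_resid: "real_polynomial_function (\<lambda>w. resid w $ i)"
  by (intro real_polynomial_function.intros(1) bounded_linear_compose[OF bounded_linear_vec_nth bounded_linear_resid])

lemma I1_ne: "I1 (M0_lin X R) \<noteq> {}"
  using k_less_n by (rule I1_nonempty)

lemma dof_pos: "real CARD('n) - (real CARD('k) - real CARD('q)) > 0"
  using k_less_n by simp

section \<open>The statistic \<open>T_uc\<close>\<close>

definition uc_form :: "real^'n \<Rightarrow> real^'q^'q" where
  "uc_form w = ((resid w \<bullet> resid w) / (real CARD('n) - (real CARD('k) - real CARD('q))))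
     *\<^sub>R (coef ** transpose coef)"

definition uc_stat :: "real^'n \<Rightarrow> real" where
  "uc_stat w = (if det (uc_form w) \<noteq> 0
     then (coef *v w) \<bullet> (matrix_inv (uc_form w) *v (coef *v w)) else 0)"

lemma inner_coef_form: "x \<bullet> ((coef ** transpose coef) *v x) = (transpose coef *v x) \<bullet> (transpose coef *v x)"
  by (simp only: matrix_vector_mul_assoc[symmetric] inner_matrix_vector_mult)

lemma det_coef_form: "det (coef ** transpose coef) \<noteq> 0"
proof (rule det_nonzero_if_trivial_kernel)
  fix x assume "(coef ** transpose coef) *v x = 0"
  then have "(transpose coef *v x) \<bullet> (transpose coef *v x) = 0"
    by (simp only: inner_coef_form[symmetric] inner_zero_right)
  then show "x = 0" by (intro transpose_coef_kernel) (simp only: inner_eq_zero_iff)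
qed

text \<open>Translates the case distinction of \<open>T_uc\<close> on membership in
  \<open>M0\<close> into the determinant condition of
  \<open>homogeneous_ratio_quadratic_form\<close>.\<close>

lemma det_uc_form: "det (uc_form w) \<noteq> 0 \<longleftrightarrow> w \<notin> M0_lin X R"
proof (cases "w \<in> M0_lin X R")
  case True
  then have "resid w = 0" by (simp add: resid_eq_0_iff)
  then have "uc_form w = mat 0" by (simp add: uc_form_def mat_def vec_eq_iff)
  then have "det (uc_form w) = 0" by (simp only: det_0)
  with True show ?thesis by simp
next
  case False
  then have "(resid w \<bullet> resid w) / (real CARD('n) - (real CARD('k) - real CARD('q))) \<noteq> 0"
    using dof_pos by (simp add: resid_eq_0_iff)
  with False show ?thesis
    unfolding uc_form_def using det_scaleR_nonzero_iff det_coef_form by blast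
qed

lemma T_uc_shift:
  assumes "\<mu> \<in> M0 X R r"
  shows "T_uc X R r (\<mu> + w) = uc_stat w"
proof -
  have "sigma2_tilde X R r (\<mu> + w) *\<^sub>R (R ** matrix_inv (transpose X ** X) ** transpose R) = uc_form w"
    by (simp only: sigma2_tilde_def u_tilde_shift[OF assms] uc_form_def coef_transpose_coef gram_inv_def)
  then show ?thesis
    by (simp only: T_uc_def M0_shift_iff[OF assms] restriction_deviation[OF assms] uc_stat_def det_uc_form)
qed

lemma invariant_test_uc:
  "invariant_test (\<lambda>w. cramer_num (uc_form w) (coef *v w)) (\<lambda>w. det (uc_form w)) uc_stat X R r (T_uc X R r)"
proof -
  \<comment> \<open>Nonconstancy needs two points. The first, \<open>w1\<close>, is orthogonal to
    the column space of \<open>X\<close>: its estimate is zero but its residual is not.\<close>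
  have "dim (range ((*v) X)) < DIM(real^'n)"
    using k_less_n rank_X by (simp add: rank_dim_range[symmetric])
  then obtain w1 where w1: "w1 \<noteq> 0" "\<And>y. y \<in> span (range ((*v) X)) \<Longrightarrow> orthogonal w1 y"
    using orthogonal_to_subspace_exists by blast
  have X_w1: "w1 \<bullet> (X *v b) = 0" for b
    using w1(2)[of "X *v b"] by (simp add: orthogonal_def span_base del: matrix_vector_mul_component)
  have w1_notin: "w1 \<notin> M0_lin X R"
  proof
    assume "w1 \<in> M0_lin X R"
    then obtain b where "w1 = X *v b" by (auto simp: M0_lin_def)
    with X_w1[of b] have "w1 \<bullet> w1 = 0" by simp
    with w1(1) show False by simp
  qed
  have "(transpose X *v w1) \<bullet> (transpose X *v w1) = 0"
    using X_w1 by (simp only: inner_matrix_vector_mult[symmetric] inner_commute[of _ w1])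
  then have "transpose X *v w1 = 0" by (simp only: inner_eq_zero_iff)
  then have "coef *v w1 = 0"
    by (simp only: coef_def matrix_vector_mul_assoc[symmetric] matrix_vector_mult_0_right)
  then have stat1: "uc_stat w1 = 0" by (simp add: uc_stat_def)
  \<comment> \<open>The second point is \<open>X *v b\<close> with \<open>R *v b\<close> nonzero, so
    it lies outside \<open>M0_lin\<close>; the vector of ones is an arbitrary nonzero
    choice.\<close>
  obtain b where b: "R *v b = (\<chi> i. 1)" using R_surj by blast
  have one: "(\<chi> i. 1) \<noteq> (0 :: real^'q)" by (simp add: vec_eq_iff)
  let ?w2 = "X *v b"
  have coef_w2: "coef *v ?w2 = (\<chi> i. 1)" by (simp only: matrix_vector_mul_assoc coef_X b)
  have w2_notin: "?w2 \<notin> M0_lin X R"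
    using coef_L[of ?w2] one coef_w2 by metis
  have stat2: "uc_stat ?w2 \<noteq> 0"
  proof -
    define A where "A = uc_form ?w2"
    define x where "x = matrix_inv A *v (coef *v ?w2)"
    have A: "det A \<noteq> 0" using w2_notin by (simp add: A_def det_uc_form)
    have Ax: "A *v x = coef *v ?w2"
      using matrix_mul_matrix_inv[OF A] by (simp only: x_def matrix_vector_mul_assoc matrix_mul_assoc matrix_mul_lid)
    then have "x \<noteq> 0" using coef_w2 one by auto
    \<comment> \<open>The statistic at \<open>?w2\<close> equals this form, a positive multiple of
      the squared length of \<open>transpose coef *v x\<close>.\<close>
    have "x \<bullet> (A *v x) \<noteq> 0"
    proof -
      let ?s = "(resid ?w2 \<bullet> resid ?w2) / (real CARD('n) - (real CARD('k) - real CARD('q)))"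
      have "?s \<noteq> 0" using w2_notin dof_pos by (simp add: resid_eq_0_iff)
      moreover have "x \<bullet> (A *v x) = ?s * ((transpose coef *v x) \<bullet> (transpose coef *v x))"
        by (simp only: A_def uc_form_def scaleR_matrix_vector_assoc[symmetric] inner_scaleR_right inner_coef_form)
      moreover have "transpose coef *v x \<noteq> 0" using \<open>x \<noteq> 0\<close> transpose_coef_kernel by blast
      ultimately show ?thesis by (simp only: mult_eq_0_iff inner_eq_zero_iff) simp
    qed
    moreover have "uc_stat ?w2 = x \<bullet> (A *v x)"
      using A by (simp only: uc_stat_def A_def[symmetric] x_def[symmetric] Ax inner_commute) simp
    ultimately show ?thesis by simp
  qed
  have "homogeneous_ratio (\<lambda>w. cramer_num (uc_form w) (coef *v w)) (\<lambda>w. det (uc_form w)) uc_stat (M0_lin X R)"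
  proof (rule homogeneous_ratio_quadratic_form[where v = "\<lambda>w. coef *v w" and M = uc_form and ?w1.0 = w1 and ?w2.0 = "X *v b"])
    show "bounded_linear (\<lambda>w. coef *v w)" by (rule matrix_vector_mul_bounded_linear)
    show "real_polynomial_function (\<lambda>w. uc_form w $ i $ j)" for i j
    proof -
      have "real_polynomial_function (\<lambda>w. resid w \<bullet> resid w)"
        unfolding inner_vec_def inner_real_def
        by (intro real_polynomial_function_sum real_polynomial_function.intros(4) polynomial_resid) simp
      then show ?thesis
        unfolding uc_form_def vector_scaleR_component real_scaleR_def
        by (intro real_polynomial_function.intros(2,4) real_polynomial_function_divide) 
    qed
    show "uc_form (c *\<^sub>R w) = c\<^sup>2 *\<^sub>R uc_form w" for c w
      by (simp add: uc_form_def resid_scale power2_eq_square)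
    show "uc_stat w1 \<noteq> uc_stat (X *v b)" using stat1 stat2 by simp
    show "uc_form (w + l) = uc_form w" if "l \<in> M0_lin X R" for l w
      using that by (simp add: uc_form_def resid_shift)
    show "det (uc_form (axis i 1)) \<noteq> 0" if "i \<in> I1 (M0_lin X R)" for i
      using that by (simp add: det_uc_form I1_def I0_def)
    show "det (uc_form w1) \<noteq> 0" "det (uc_form (X *v b)) \<noteq> 0"
      by (simp_all only: det_uc_form w1_notin w2_notin not_False_eq_True)
    show "uc_stat w = (if det (uc_form w) \<noteq> 0
        then (coef *v w) \<bullet> (matrix_inv (uc_form w) *v (coef *v w)) else 0)" for w
      by (rule uc_stat_def)
  qed (fact subspace_M0_lin I1_ne coef_L)+
  then show ?thesis
    by (intro invariant_test.intro invariant_test_axioms.intro T_uc_shift M0_ne)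
qed

end

section \<open>The statistic \<open>T_Het\<close>\<close>

locale het_regression = restricted_regression X R r
  for X :: "real^'k^'n" and R :: "real^'k^'q" and r :: "real^'q" +
  fixes d :: "real^'n"
  assumes d_pos: "d $ i > 0"
begin

definition het_form :: "real^'n \<Rightarrow> real^'q^'q" where
  "het_form w = coef ** diag (\<chi> i. d $ i * (resid w $ i)\<^sup>2) ** transpose coef"

definition het_stat :: "real^'n \<Rightarrow> real" where
  "het_stat w = (if det (het_form w) \<noteq> 0
     then (coef *v w) \<bullet> (matrix_inv (het_form w) *v (coef *v w)) else 0)"

lemma T_Het_shift:
  assumes "\<mu> \<in> M0 X R r"
  shows "T_Het X R r d (\<mu> + w) = het_stat w"
proof -
  have "Omega_Het X R r d (\<mu> + w) = het_form w"
    by (simp only: Omega_Het_def u_tilde_shift[OF assms] het_form_def transpose_coef)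
       (simp only: coef_def gram_inv_def matrix_mul_assoc)
  then show ?thesis
    by (simp only: T_Het_def restriction_deviation[OF assms] het_stat_def)
qed

lemma B_tilde_shift:
  assumes "\<mu> \<in> M0 X R r"
  shows "\<mu> + w \<in> B_tilde X R r \<longleftrightarrow> rank (coef ** diag (resid w)) < CARD('q)"
  by (simp only: B_tilde_def B_tilde_mat_def u_tilde_shift[OF assms] mem_Collect_eq coef_def gram_inv_def)

text \<open>Since each \<open>d $ i\<close> is positive, a kernel vector of
  \<open>het_form w\<close> is annihilated by the transpose of
  \<open>coef ** diag (resid w)\<close>. Outside \<open>B_tilde\<close> that matrix has full row
  rank, so the vector is zero.\<close>

lemma det_het_form:
  assumes "\<mu> \<in> M0 X R r" "\<mu> + w \<notin> B_tilde X R r"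
  shows "det (het_form w) \<noteq> 0"
proof (rule det_nonzero_if_trivial_kernel)
  fix x assume "het_form w *v x = 0"
  then have "x \<bullet> (het_form w *v x) = 0" by simp
  then have "(\<Sum>i\<in>UNIV. (d $ i * (resid w $ i)\<^sup>2) * ((transpose coef *v x) $ i)\<^sup>2) = 0"
    unfolding het_form_def inner_congruence_diag by (simp only: vec_lambda_beta)
  then have "(d $ i * (resid w $ i)\<^sup>2) * ((transpose coef *v x) $ i)\<^sup>2 = 0" for i
    by (subst (asm) sum_nonneg_eq_0_iff) (simp_all add: d_pos less_imp_le del: matrix_vector_mul_component)
  then have "d $ i = 0 \<or> resid w $ i = 0 \<or> (transpose coef *v x) $ i = 0" for i
    by (simp del: matrix_vector_mul_component)
  then have "resid w $ i = 0 \<or> (transpose coef *v x) $ i = 0" for i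
    using d_pos[of i] by (metis less_irrefl)
  then have "resid w * (transpose coef *v x) = 0"
    by (simp add: vec_eq_iff del: matrix_vector_mul_component)
  then have ker: "transpose (coef ** diag (resid w)) *v x = 0"
  proof -
    have "transpose (diag (resid w)) = diag (resid w)"
      by (auto simp: transpose_def diag_def vec_eq_iff)
    then show ?thesis
      using \<open>resid w * (transpose coef *v x) = 0\<close>
      by (simp only: matrix_transpose_mul matrix_vector_mul_assoc[symmetric] diag_mult_vec)
  qed
  have "rank (transpose (coef ** diag (resid w))) = CARD('q)"
    using assms B_tilde_shift[OF assms(1), of w] rank_bound[of "coef ** diag (resid w)"]
    by (simp add: rank_transpose)
  with ker show "x = 0"
    using matrix_nonfull_linear_equations_eq by blast
qed

lemma N_Het_invariant:
  assumes "\<mu>0 \<in> M0 X R r" "\<mu>1 \<in> M0 X R r"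
  shows "N_Het X R r \<mu>0 \<longleftrightarrow> N_Het X R r \<mu>1"
  by (simp only: N_Het_def B_tilde_shift[OF assms(1)] B_tilde_shift[OF assms(2)])

text \<open>Two points outside \<open>B_tilde\<close> with different values provide nonconstancy,
  and \<open>N_Het\<close> provides invertibility at the basis vectors.\<close>

lemma invariant_test_Het:
  assumes nonconst: "\<not> T_Het X R r d constant_on (UNIV - B_tilde X R r)"
    and \<mu>: "\<mu> \<in> M0 X R r" "N_Het X R r \<mu>"
  shows "invariant_test (\<lambda>w. cramer_num (het_form w) (coef *v w)) (\<lambda>w. det (het_form w)) het_stat
    X R r (T_Het X R r d)"
proof -
  obtain y1 y2 where y: "y1 \<notin> B_tilde X R r" "y2 \<notin> B_tilde X R r" "T_Het X R r d y1 \<noteq> T_Het X R r d y2"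
    using nonconst unfolding constant_on_def by (metis DiffE)
  have w: "det (het_form (y1 - \<mu>)) \<noteq> 0" "det (het_form (y2 - \<mu>)) \<noteq> 0"
      "het_stat (y1 - \<mu>) \<noteq> het_stat (y2 - \<mu>)"
    using y det_het_form[OF \<mu>(1), of "y1 - \<mu>"] det_het_form[OF \<mu>(1), of "y2 - \<mu>"]
      T_Het_shift[OF \<mu>(1), of "y1 - \<mu>"] T_Het_shift[OF \<mu>(1), of "y2 - \<mu>"] by simp_all
  have "homogeneous_ratio (\<lambda>w. cramer_num (het_form w) (coef *v w)) (\<lambda>w. det (het_form w)) het_stat (M0_lin X R)"
  proof (rule homogeneous_ratio_quadratic_form[where v = "\<lambda>w. coef *v w" and M = het_form and ?w1.0 = "y1 - \<mu>" and ?w2.0 = "y2 - \<mu>"])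
    show "bounded_linear (\<lambda>w. coef *v w)" by (rule matrix_vector_mul_bounded_linear)
    \<comment> \<open>Entrywise the form is quadratic in the residuals, which yields both the
      polynomial property and the scaling by the square of \<open>c\<close>.\<close>
    have entry: "het_form w $ i $ j = (\<Sum>l\<in>UNIV. coef $ i $ l * (d $ l * (resid w $ l)\<^sup>2) * coef $ j $ l)" for w i j
    proof -
      have "(coef ** diag e) $ i $ l = coef $ i $ l * e $ l" for e :: "real^'n" and l
      proof -
        have "(coef ** diag e) $ i $ l = (\<Sum>m\<in>UNIV. if m = l then coef $ i $ m * e $ m else 0)"
          unfolding matrix_matrix_mult_def diag_def by (simp only: vec_lambda_beta) (rule sum.cong, auto)
        then show ?thesis by simp
      qed
      then show ?thesis
        unfolding het_form_def by (subst matrix_matrix_mult_def) (simp add: transpose_def)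
    qed
    show "real_polynomial_function (\<lambda>w. het_form w $ i $ j)" for i j
      unfolding entry
      by (intro real_polynomial_function_sum real_polynomial_function.intros(2,4)
          real_polynomial_function_power polynomial_resid) simp
    show "het_form (c *\<^sub>R w) = c\<^sup>2 *\<^sub>R het_form w" for c w
      by (simp add: vec_eq_iff entry resid_scale sum_distrib_left power_mult_distrib algebra_simps)
    show "het_form (w + l) = het_form w" if "l \<in> M0_lin X R" for l w
      using that by (simp add: het_form_def resid_shift)
    show "det (het_form (axis i 1)) \<noteq> 0" if "i \<in> I1 (M0_lin X R)" for i
      using that \<mu>(2) by (intro det_het_form[OF \<mu>(1)]) (simp add: N_Het_def)
    show "het_stat w = (if det (het_form w) \<noteq> 0
        then (coef *v w) \<bullet> (matrix_inv (het_form w) *v (coef *v w)) else 0)" for w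
      by (rule het_stat_def)
  qed (fact w subspace_M0_lin I1_ne coef_L)+
  then show ?thesis
    by (intro invariant_test.intro invariant_test_axioms.intro T_Het_shift M0_ne)
qed

end

theorem theorem6p4:
  fixes X :: "real^'k^'n" and R :: "real^'k^'q" and r :: "real^'q" and d :: "real^'n"
  assumes "CARD('k) < CARD('n)"
    and "rank X = CARD('k)"
    and "rank R = CARD('q)"
    and "\<forall>i. d $ i > 0"
  shows
    "(\<forall>\<alpha>\<in>{0<..<1}. \<exists>C. test_size X R r (T_uc X R r) C \<le> \<alpha>)
      \<and> (\<forall>\<mu>0\<in>M0 X R r. \<forall>\<mu>1\<in>M0 X R r.
            C_star X R (T_uc X R r) \<mu>0 = C_star X R (T_uc X R r) \<mu>1
          \<and> alpha_star X R (T_uc X R r) \<mu>0 = alpha_star X R (T_uc X R r) \<mu>1)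
      \<and> (\<forall>\<mu>0\<in>M0 X R r. \<forall>\<alpha>\<in>{0<..alpha_star X R (T_uc X R r) \<mu>0} \<inter> {0<..<1}.
            \<exists>C. test_size X R r (T_uc X R r) C = \<alpha>)
    \<and> (Assumption2 X R \<and> \<not> T_Het X R r d constant_on (UNIV - B_tilde X R r) \<longrightarrow>
        ((\<exists>\<mu>0\<in>M0 X R r. N_Het X R r \<mu>0) \<longrightarrow> (\<forall>\<mu>0\<in>M0 X R r. N_Het X R r \<mu>0))
      \<and> ((\<exists>\<mu>0\<in>M0 X R r. N_Het X R r \<mu>0) \<longrightarrow>
            (\<forall>\<alpha>\<in>{0<..<1}. \<exists>C. test_size X R r (T_Het X R r d) C \<le> \<alpha>)
          \<and> (\<forall>\<mu>0\<in>M0 X R r. \<forall>\<mu>1\<in>M0 X R r.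
                C_star X R (T_Het X R r d) \<mu>0 = C_star X R (T_Het X R r d) \<mu>1
              \<and> alpha_star X R (T_Het X R r d) \<mu>0 = alpha_star X R (T_Het X R r d) \<mu>1)
          \<and> (\<forall>\<mu>0\<in>M0 X R r. \<forall>\<alpha>\<in>{0<..alpha_star X R (T_Het X R r d) \<mu>0} \<inter> {0<..<1}.
                \<exists>C. test_size X R r (T_Het X R r d) C = \<alpha>)))
    \<and> (\<forall>\<alpha>\<in>{0<..<1}. \<exists>C_min.
        is_smallest C_min {C. test_size X R r (T_uc X R r) C \<le> \<alpha>}
      \<and> ((\<exists>C. test_size X R r (T_uc X R r) C = \<alpha>) \<longrightarrow>
            is_smallest C_min {C. test_size X R r (T_uc X R r) C = \<alpha>}))
    \<and> (Assumption2 X R \<and> \<not> T_Het X R r d constant_on (UNIV - B_tilde X R r)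
        \<and> (\<exists>\<mu>0\<in>M0 X R r. N_Het X R r \<mu>0) \<longrightarrow>
      (\<forall>\<alpha>\<in>{0<..<1}. \<exists>C_min.
        is_smallest C_min {C. test_size X R r (T_Het X R r d) C \<le> \<alpha>}
      \<and> ((\<exists>C. test_size X R r (T_Het X R r d) C = \<alpha>) \<longrightarrow>
            is_smallest C_min {C. test_size X R r (T_Het X R r d) C = \<alpha>})))"
proof -
  interpret het_regression X R r d
    using assms by unfold_locales auto
  note uc = invariant_test_uc
  have het: "invariant_test (\<lambda>w. cramer_num (het_form w) (coef *v w)) (\<lambda>w. det (het_form w)) het_stat
      X R r (T_Het X R r d)"
    if "\<not> T_Het X R r d constant_on (UNIV - B_tilde X R r)" "\<exists>\<mu>0\<in>M0 X R r. N_Het X R r \<mu>0"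
    using that invariant_test_Het by blast
  show ?thesis
  \<comment> \<open>Goals 1 to 3 treat size control, invariance and exactness for
    \<open>T_uc\<close>; goal 4 is the independence of \<open>N_Het\<close> from the base point;
    goals 5 to 7 repeat the first three for \<open>T_Het\<close>; goals 8 and 9 concern smallest
    critical values.\<close>
  proof (intro conjI impI, goal_cases)
    case 1
    show ?case by (rule invariant_test.size_controllable[OF uc])
  next
    case 2
    show ?case by (rule invariant_test.star_invariant[OF uc])
  next
    case 3
    show ?case by (rule invariant_test.exact_size[OF uc])
  next
    case 4
    then show ?case using N_Het_invariant by blast
  next
    case 5
    then show ?case by (intro invariant_test.size_controllable[OF het]) blast+
  next
    case 6
    then show ?case by (intro invariant_test.star_invariant[OF het]) blast+
  next
    case 7
    then show ?case by (intro invariant_test.exact_size[OF het]) blast+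
  next
    case 8
    show ?case by (rule invariant_test.smallest_critical_value[OF uc])
  next
    case 9
    then show ?case by (intro invariant_test.smallest_critical_value[OF het]) blast+
  qed
qed

end
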